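(* Let $\alpha\in\mathbb{C}$ with $|\alpha|\le1$. (a) Each function in $\mathcal{M}(\alpha)$ maps the disk $|z|<2-\sqrt3$ onto a convex domain. (b) Each function in $\mathcal{M}(\alpha)$ maps the disk $|z|<4\sqrt2-5$ onto a starlike domain.
   Context: $\mathbb{D}=\{z\in\mathbb{C}:|z|<1\}$. For $|\alpha|\le1$, $\mathcal{M}(\alpha)$ is the set of all harmonic functions $f=h+\overline{g}$ in $\mathbb{D}$, with $h(z)=z+\sum_{n\ge2}a_nz^n$ and $g(z)=\sum_{n\ge1}b_nz^n$ analytic in $\mathbb{D}$, such that $g'(z)=\alpha zh'(z)$ and $\operatorname{Re}\left(1+\frac{zh''(z)}{h'(z)}\right)>-\frac12$ for all $z\in\mathbb{D}$ (in particular $h'$ has no zeros in $\mathbb{D}$). Starlike means starlike with respect to the origin. *)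

theory Defs
  imports "HOL-Complex_Analysis.Complex_Analysis"
begin

text \<open>
  The power series conditions \<open>h(z) = z + a\<^sub>2z\<^sup>2 + \<dots>\<close> and \<open>g(z) = b\<^sub>1z + \<dots>\<close> are
  the normalisations \<open>h(0) = 0\<close>, \<open>h'(0) = 1\<close>, \<open>g(0) = 0\<close> of holomorphic functions.
  Functions are total, so only the values of \<open>f\<close>, \<open>h\<close>, \<open>g\<close> on the unit disk are constrained.
  As \<open>x / 0 = 0\<close>, the condition that \<open>h'\<close> has no zeros, implicit in the inequality, is
  listed separately.
\<close>

definition harmonic_M :: "complex \<Rightarrow> (complex \<Rightarrow> complex) set" where
  "harmonic_M \<alpha> = {f. \<exists>h g.
     h holomorphic_on ball 0 1 \<and> h 0 = 0 \<and> deriv h 0 = 1 \<and>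
     g holomorphic_on ball 0 1 \<and> g 0 = 0 \<and>
     (\<forall>z\<in>ball 0 1.
        f z = h z + cnj (g z) \<and>
        deriv g z = \<alpha> * z * deriv h z \<and>
        deriv h z \<noteq> 0 \<and>
        Re (1 + z * deriv (deriv h) z / deriv h z) > - 1 / 2)}"

definition domain_in_plane :: "complex set \<Rightarrow> bool" where
  "domain_in_plane S \<longleftrightarrow> open S \<and> connected S \<and> S \<noteq> {}"

definition convex_domain :: "complex set \<Rightarrow> bool" where
  "convex_domain S \<longleftrightarrow> domain_in_plane S \<and> convex S"

text \<open>The library predicate \<^const>\<open>starlike\<close> leaves the centre existentially quantified;
  here it is the origin.\<close>

definition starlike_domain :: "complex set \<Rightarrow> bool" where
  "starlike_domain S \<longleftrightarrow> domain_in_plane S \<and> 0 \<in> S \<and> (\<forall>w\<in>S. closed_segment 0 w \<subseteq> S)"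

end

theory Submission
  imports Defs
begin

text \<open>
  Let \<open>f = h + cnj g\<close> be in the class with parameter \<open>\<alpha>\<close>. The proof is about the analytic functions
  \<open>F = h + e * g\<close> with \<open>norm e \<le> 1\<close>. They satisfy \<open>deriv F z = (1 + b * z) * deriv h z\<close> with
  \<open>b = e * \<alpha>\<close>, so \<open>norm b \<le> 1\<close>.

  Reduction to analytic functions. If every \<open>F\<close> with \<open>norm e = 1\<close> maps the circles in a disk to convex
  curves, then \<open>f\<close> maps the disk onto a convex domain, because in each direction the height of \<open>f\<close> equals the
  height of one of the \<open>F\<close> (\<open>convex_image\<close>). If every \<open>F\<close> is starlike, so is \<open>f\<close>, because for each line
  through the origin there is an \<open>F\<close> that takes values on this line at the same points as \<open>f\<close>, on the same side of
  the origin (\<open>starlike_image\<close>). As \<open>f\<close> is open, the frontier of the image of a closed disk lies in the image \<open>C\<close>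
  of the bounding circle. A compact set with interior points is convex when each point of such a \<open>C\<close> has a
  supporting line; a closed set that contains the origin is starlike when \<open>C\<close> avoids the origin and each ray
  meets \<open>C\<close> at most once.

  Convexity. The condition on \<open>h\<close> means \<open>deriv (deriv h) z / deriv h z = 3 * e / (1 - e * z)\<close> with
  \<open>norm e \<le> 1\<close> depending on \<open>z\<close>. Elementary estimates then give
  \<open>Re (1 + z * deriv (deriv F) z / deriv F z) \<ge> (1 - 4 * r + r\<^sup>2) / (1 - r\<^sup>2)\<close> on \<open>norm z = r\<close>
  (\<open>convexity_quotient\<close>).

  Starlikeness. Pointwise estimates do not give the radius \<open>4 * sqrt 2 - 5\<close>, which is that of close-to-convex
  functions. The family of functions \<open>F\<close> is, up to normalisation, invariant under disk automorphisms, and moving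
  \<open>a\<close> to the origin turns the quotient \<open>F a / (a * deriv F a)\<close> into \<open>1 - (norm a)\<^sup>2\<close> times
  \<open>\<integral>s\<in>{0..1}. (1 - m * s) * K (- a * s) ^ 3\<close>. Here \<open>K\<close> is the cube root of the transformed
  derivative of \<open>h\<close>, and \<open>Re K > 1 / 2\<close> by Jack's lemma. Such a \<open>K\<close> is an average of kernels
  \<open>1 / (1 - y * z)\<close>, and a product of three kernels is an average of cubes of single kernels. So it is
  enough to bound the integral for \<open>K = (\<lambda>z. 1 / (1 - y * z))\<close>, where it is explicit and its real
  part is positive in the required range (\<open>kernel_bound_cube\<close>, \<open>starlikeness_quotient\<close>).
\<close>

section \<open>Convexity and starlikeness from the frontier\<close>

text \<open>A segment from an interior point to a point \<open>z\<close> outside \<open>K\<close> leaves \<open>K\<close> at a frontier point \<open>p\<close>.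
  The supporting functional at \<open>p\<close> is strictly below its value at \<open>p\<close> on the interior, so it is strictly
  above that value at \<open>z\<close>; hence \<open>z\<close> is no convex combination of points of \<open>K\<close>. It is enough to test the
  functional on \<open>C\<close>, because its maximum over \<open>K\<close> is attained on the frontier.\<close>
lemma convex_if_frontier_supported:
  fixes K :: "'a::euclidean_space set"
  assumes K: "compact K" "interior K \<noteq> {}" and C: "frontier K \<subseteq> C"
    and supp: "\<And>p. p \<in> C \<Longrightarrow> \<exists>n. n \<noteq> 0 \<and> (\<forall>y\<in>C. n \<bullet> y \<le> n \<bullet> p)"
  shows "convex K"
proof -
  have strict: "n \<bullet> y < n \<bullet> p" 
    if n: "n \<noteq> 0" "\<And>y. y \<in> K \<Longrightarrow> n \<bullet> y \<le> n \<bullet> p" and y: "y \<in> interior K" for n p y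
  proof -
    obtain e where e: "e > 0" "cball y e \<subseteq> K"
      using y by (meson mem_interior_cball)
    have "dist y (y + (e / norm n) *\<^sub>R n) \<le> e"
      using n(1) e(1) by (simp add: dist_norm)
    hence "n \<bullet> (y + (e / norm n) *\<^sub>R n) \<le> n \<bullet> p"
      using e n(2) by (meson mem_cball subsetD)
    moreover have "n \<bullet> ((e / norm n) *\<^sub>R n) > 0"
      using n(1) e(1) by simp
    ultimately show ?thesis by (simp add: inner_add_right)
  qed
  have supp': "\<exists>n. n \<noteq> 0 \<and> (\<forall>y\<in>K. n \<bullet> y \<le> n \<bullet> p)" if p: "p \<in> C" for p
  proof -
    obtain n where n: "n \<noteq> 0" "\<forall>y\<in>C. n \<bullet> y \<le> n \<bullet> p" using supp[OF p] by blast
    have "K \<noteq> {}" using K(2) interior_subset by fastforce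
    then obtain q where q: "q \<in> K" "\<And>y. y \<in> K \<Longrightarrow> n \<bullet> y \<le> n \<bullet> q"
      using continuous_attains_sup[OF K(1) _ continuous_on_inner[OF continuous_on_const continuous_on_id], of n]
      by auto
    have "q \<notin> interior K" using strict[OF n(1) q(2), of q] by auto
    hence "q \<in> C" using q(1) K(1) C closure_subset by (auto simp: frontier_def)
    thus ?thesis using n q by (meson order_trans)
  qed
  obtain i where i: "i \<in> interior K" using K(2) by blast
  show ?thesis
    unfolding convex_contains_segment
  proof (intro ballI subsetI)
    fix x y z assume x: "x \<in> K" and y: "y \<in> K" and z: "z \<in> closed_segment x y"
    show "z \<in> K"
    proof (rule ccontr)
      assume "z \<notin> K"
      hence "closed_segment i z \<inter> frontier K \<noteq> {}"
        using i interior_subset by (intro connected_Int_frontier) (auto intro!: connected_segment)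
      then obtain p where p: "p \<in> closed_segment i z" "p \<in> frontier K" by blast
      obtain n where n: "n \<noteq> 0" "\<And>y. y \<in> K \<Longrightarrow> n \<bullet> y \<le> n \<bullet> p"
        using supp'[of p] p(2) C by blast
      have ni: "n \<bullet> i < n \<bullet> p" by (rule strict[OF n i])
      obtain t where t: "0 \<le> t" "t \<le> 1" "z = (1 - t) *\<^sub>R x + t *\<^sub>R y"
        using z by (auto simp: in_segment)
      have nz: "n \<bullet> z \<le> n \<bullet> p"
        using convex_bound_le[OF n(2)[OF x] n(2)[OF y], of "1-t" t] t by (simp add: inner_add_right)
      obtain s where s: "0 \<le> s" "s \<le> 1" "p = (1 - s) *\<^sub>R i + s *\<^sub>R z"
        using p(1) by (auto simp: in_segment)
      have pK: "p \<in> K" using p(2) K(1) by (simp add: frontier_def compact_imp_closed)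
      hence "s < 1" using s \<open>z \<notin> K\<close> by (cases "s = 1") auto
      have "n \<bullet> p = (1 - s) * (n \<bullet> i) + s * (n \<bullet> z)" unfolding s(3) by (simp add: inner_add_right)
      also have "\<dots> < (1 - s) * (n \<bullet> p) + s * (n \<bullet> p)"
        using \<open>s < 1\<close> s(1) ni nz by (intro add_less_le_mono mult_strict_left_mono mult_left_mono) auto
      finally show False by (simp add: algebra_simps)
    qed
  qed
qed

text \<open>If a point of the segment from \<open>0\<close> to \<open>w\<close> were missing from \<open>K\<close>, the frontier would meet the segment
  on both sides of the missing point. Neither of these points is \<open>0\<close>, so \<open>C\<close> would contain two points of one
  ray.\<close>
lemma segments_from_0_if_frontier_meets_rays_once:
  fixes K :: "'a::real_normed_vector set"
  assumes K: "closed K" "0 \<in> K" and C: "frontier K \<subseteq> C" and "0 \<notin> C"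
    and ray: "\<And>p c. p \<in> C \<Longrightarrow> c *\<^sub>R p \<in> C \<Longrightarrow> c > 0 \<Longrightarrow> c = 1"
    and w: "w \<in> K"
  shows "closed_segment 0 w \<subseteq> K"
proof (rule ccontr)
  assume "\<not> ?thesis"
  then obtain z where "z \<in> closed_segment 0 w" "z \<notin> K" by blast
  then obtain s where s: "0 \<le> s" "s \<le> 1" "s *\<^sub>R w \<notin> K"
    by (auto simp: in_segment)
  have "closed_segment 0 (s *\<^sub>R w) \<inter> frontier K \<noteq> {}"
    using s K by (intro connected_Int_frontier) (auto intro!: connected_segment)
  then obtain p where p: "p \<in> closed_segment 0 (s *\<^sub>R w)" "p \<in> C" "p \<in> K"
    using C K(1) by (auto simp: frontier_def)
  have "closed_segment (s *\<^sub>R w) w \<inter> frontier K \<noteq> {}"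
    using s w by (intro connected_Int_frontier) (auto intro!: connected_segment)
  then obtain q where q: "q \<in> closed_segment (s *\<^sub>R w) w" "q \<in> C" "q \<in> K"
    using C K(1) by (auto simp: frontier_def)
  obtain a where a: "0 \<le> a" "a \<le> 1" "p = (a * s) *\<^sub>R w"
    using p(1) by (auto simp: in_segment)
  obtain b where b: "0 \<le> b" "b \<le> 1" "q = (1 - b) *\<^sub>R s *\<^sub>R w + b *\<^sub>R w"
    using q(1) by (auto simp: in_segment)
  have qe: "q = (s + b * (1 - s)) *\<^sub>R w" unfolding b(3) by (simp add: algebra_simps)
  have "a * s \<noteq> 0" using a p(2) \<open>0 \<notin> C\<close> by auto
  hence "a > 0" "s > 0" using a(1) s(1) by (auto simp: less_le)
  have "s \<noteq> 1" using s w by auto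
  have "a \<noteq> 1" using p(3) a s by auto
  have "b \<noteq> 0" using q(3) b s by auto
  have gt: "s + b * (1 - s) > a * s"
  proof -
    have "a * s < s" using \<open>a \<noteq> 1\<close> a \<open>s > 0\<close> by simp
    moreover have "b * (1 - s) \<ge> 0" using b s by simp
    ultimately show ?thesis by linarith
  qed
  have "((s + b * (1 - s)) / (a * s)) *\<^sub>R p \<in> C"
    using q(2) \<open>a * s \<noteq> 0\<close> by (simp add: a(3) qe)
  hence "(s + b * (1 - s)) / (a * s) = 1"
    using \<open>a > 0\<close> \<open>s > 0\<close> b s by (intro ray[OF p(2)]) (auto intro!: divide_pos_pos add_pos_nonneg)
  thus False using gt \<open>a * s \<noteq> 0\<close> by simp
qed

section \<open>Arguments along circles\<close>

text \<open>For \<open>P z = z * exp (L z)\<close> this is a continuous choice of the argument of \<open>P\<close> along the circle of radius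
  \<open>\<rho>\<close>; the factor \<open>z\<close> gives it winding number one. It serves both the position vector of a curve
  (starlikeness, \<open>P = F\<close>) and its tangent (convexity, \<open>P z = z * deriv F z\<close>).\<close>
definition circle_angle :: "(complex \<Rightarrow> complex) \<Rightarrow> real \<Rightarrow> real \<Rightarrow> real" where
  "circle_angle L \<rho> t = t + Im (L (of_real \<rho> * cis t))"

lemma polar_form_circle_angle:
  "(of_real \<rho> * cis t) * exp (L (of_real \<rho> * cis t)) =
     of_real (\<rho> * exp (Re (L (of_real \<rho> * cis t)))) * cis (circle_angle L \<rho> t)"
  by (simp add: exp_eq_polar[of "L _"] circle_angle_def flip: cis_mult)

lemma circle_angle_periodic: "circle_angle L \<rho> (t + 2 * pi) = circle_angle L \<rho> t + 2 * pi"
  by (simp add: circle_angle_def flip: cis_mult)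

lemma has_vector_derivative_on_circle:
  assumes "f holomorphic_on ball 0 R" "\<bar>\<rho>\<bar> < R"
  shows "((\<lambda>t. f (of_real \<rho> * cis t)) has_vector_derivative
           \<i> * (of_real \<rho> * cis t * deriv f (of_real \<rho> * cis t))) (at t)"
proof -
  have "(f has_field_derivative deriv f (of_real \<rho> * cis t)) (at (of_real \<rho> * cis t))"
    using assms by (intro holomorphic_derivI[of _ "ball 0 R"]) (auto simp: norm_mult)
  moreover have "((\<lambda>t. of_real \<rho> * cis t) has_vector_derivative (of_real \<rho> * (\<i> * cis t))) (at t)"
    by (auto simp: has_vector_derivative_complex_iff intro!: derivative_eq_intros)
  ultimately show ?thesis
    using field_vector_diff_chain_at by (fastforce simp: o_def mult_ac)
qed

lemma circle_angle_deriv: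
  assumes "L holomorphic_on ball 0 R" "\<bar>\<rho>\<bar> < R"
  shows "(circle_angle L \<rho> has_real_derivative
           Re (1 + of_real \<rho> * cis t * deriv L (of_real \<rho> * cis t))) (at t)"
proof -
  have "((\<lambda>t. Im (L (of_real \<rho> * cis t))) has_real_derivative
           Re (of_real \<rho> * cis t * deriv L (of_real \<rho> * cis t))) (at t)"
    using has_vector_derivative_on_circle[OF assms, of t]
    by (simp add: has_vector_derivative_complex_iff)
  from DERIV_add[OF DERIV_ident this] show ?thesis
    by (simp add: circle_angle_def[abs_def])
qed

text \<open>The argument of \<open>z * exp (L z)\<close> is strictly increasing and gains exactly \<open>2 * pi\<close> in one turn, so no value
  modulo \<open>2 * pi\<close> is taken twice.\<close>
lemma ray_meets_circle_image_once:
  assumes L: "L holomorphic_on ball 0 R" and pos: "\<And>z. z \<in> ball 0 R \<Longrightarrow> Re (1 + z * deriv L z) > 0"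
    and z: "norm z1 = \<rho>" "norm z2 = \<rho>" "0 < \<rho>" "\<rho> < R"
    and c: "c > 0" "z2 * exp (L z2) = of_real c * (z1 * exp (L z1))"
  shows "z1 = z2"
proof -
  define t1 where "t1 = Arg2pi z1"
  define d where "d = Arg2pi (z2 / z1)"
  have z1: "z1 = of_real \<rho> * cis t1"
    using Arg2pi_eq[of z1] z by (simp add: t1_def cis_conv_exp)
  have nz: "z1 \<noteq> 0" using z by auto
  have "z2 / z1 = cis d"
    using Arg2pi_eq[of "z2 / z1"] z by (simp add: d_def cis_conv_exp norm_divide)
  hence z2: "z2 = of_real \<rho> * cis (t1 + d)"
    using nz by (simp add: field_simps z1 flip: cis_mult)
  have d: "0 \<le> d" "d < 2 * pi" using Arg2pi[of "z2 / z1"] by (auto simp: d_def)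
  have incr: "circle_angle L \<rho> s < circle_angle L \<rho> t" if "s < t" for s t
  proof (rule DERIV_pos_imp_increasing[OF that])
    fix x
    have "of_real \<rho> * cis x \<in> ball 0 R" using z by (simp add: norm_mult)
    thus "\<exists>y. (circle_angle L \<rho> has_real_derivative y) (at x) \<and> 0 < y"
      using circle_angle_deriv[OF L, of \<rho> x] pos z by fastforce
  qed
  define r1 where "r1 = \<rho> * exp (Re (L z1))"
  define r2 where "r2 = \<rho> * exp (Re (L z2))"
  have r: "r1 > 0" "r2 > 0" using z by (auto simp: r1_def r2_def)
  have eq: "of_real r2 * cis (circle_angle L \<rho> (t1 + d)) = of_real (c * r1) * cis (circle_angle L \<rho> t1)"
  proof -
    have "z2 * exp (L z2) = of_real r2 * cis (circle_angle L \<rho> (t1 + d))"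
      using polar_form_circle_angle[of \<rho> "t1 + d" L] by (simp only: z2[symmetric] r2_def)
    moreover have "z1 * exp (L z1) = of_real r1 * cis (circle_angle L \<rho> t1)"
      using polar_form_circle_angle[of \<rho> t1 L] by (simp only: z1[symmetric] r1_def)
    ultimately show ?thesis using c(2) by (simp add: mult.assoc)
  qed
  have "norm (of_real r2 * cis (circle_angle L \<rho> (t1 + d))) = norm (of_real (c * r1) * cis (circle_angle L \<rho> t1))"
    by (simp only: eq)
  hence "r2 = c * r1" using r c by (simp add: norm_mult)
  hence "cis (circle_angle L \<rho> (t1 + d)) = cis (circle_angle L \<rho> t1)" using eq r c by simp
  then obtain n :: int where n: "circle_angle L \<rho> (t1 + d) = circle_angle L \<rho> t1 + 2 * n * pi"
    using sin_cos_eq_iff[of "circle_angle L \<rho> (t1 + d)" "circle_angle L \<rho> t1"] by (auto simp: complex_eq_iff)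
  have "\<not> 0 < d"
  proof
    assume "0 < d"
    hence "circle_angle L \<rho> t1 < circle_angle L \<rho> (t1 + d)" "circle_angle L \<rho> (t1 + d) < circle_angle L \<rho> (t1 + 2 * pi)"
      using d by (auto intro!: incr)
    hence "0 < 2 * n * pi" "2 * n * pi < 2 * pi" unfolding n circle_angle_periodic by auto
    hence "0 < n" "n < 1" by (auto simp: zero_less_mult_iff)
    thus False by linarith
  qed
  thus ?thesis using d z1 z2 by auto
qed

text \<open>The derivative of \<open>Im (c * F z)\<close> along the circle is a positive multiple of the cosine of the (rotated)
  tangent angle. This angle increases by \<open>2 * pi\<close> in one turn, and the cosine vanishes at the starting point
  \<open>z0\<close>, so the derivative has one sign up to a rotation of the tangent by \<open>pi\<close> and the other sign afterwards.
  Thus \<open>Im (c * F z)\<close> first moves away from its value at \<open>z0\<close> and then returns to it.\<close>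
lemma circle_image_supported_at_critical_direction:
  assumes F: "F holomorphic_on ball 0 R" and L: "L holomorphic_on ball 0 R"
    and FL: "\<And>z. z \<in> ball 0 R \<Longrightarrow> deriv F z = exp (L z)"
    and pos: "\<And>z. z \<in> ball 0 R \<Longrightarrow> Re (1 + z * deriv L z) \<ge> 0"
    and z0: "norm z0 = \<rho>" "0 < \<rho>" "\<rho> < R" 
    and crit: "Re (c * (z0 * deriv F z0)) = 0"
  shows "(\<forall>z. norm z = \<rho> \<longrightarrow> Im (c * F z) \<le> Im (c * F z0)) \<or>
         (\<forall>z. norm z = \<rho> \<longrightarrow> Im (c * F z0) \<le> Im (c * F z))"
proof (cases "c = 0")
  case False
  define s where "s = Arg2pi z0"
  have z0s: "z0 = of_real \<rho> * cis s"
    using Arg2pi_eq[of z0] z0 by (simp add: s_def cis_conv_exp)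
  have inb: "of_real \<rho> * cis t \<in> ball 0 R" for t using z0 by (simp add: norm_mult)
  define \<gamma> where "\<gamma> = Arg2pi c"
  have c: "c = of_real (norm c) * cis \<gamma>"
    using Arg2pi_eq[of c] by (simp add: \<gamma>_def cis_conv_exp)
  define \<theta> where "\<theta> = circle_angle L \<rho>"
  define A where "A t = norm c * (\<rho> * exp (Re (L (of_real \<rho> * cis t))))" for t
  have A: "A t > 0" for t using False z0 by (simp add: A_def)
  define \<sigma> where "\<sigma> = - sin (\<gamma> + \<theta> s)"
  define \<delta> where "\<delta> t = \<theta> t - \<theta> s" for t
  have tang: "Re (c * (of_real \<rho> * cis t * deriv F (of_real \<rho> * cis t))) = A t * cos (\<gamma> + \<theta> t)" for t
  proof -
    have "c * (of_real \<rho> * cis t * deriv F (of_real \<rho> * cis t)) = of_real (A t) * cis (\<gamma> + \<theta> t)"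
      unfolding FL[OF inb] polar_form_circle_angle
      by (subst c) (simp add: A_def \<theta>_def flip: cis_mult)
    thus ?thesis by simp
  qed
  have cos0: "cos (\<gamma> + \<theta> s) = 0"
    using crit tang[of s] A[of s] by (simp add: z0s)
  \<comment> \<open>Since \<open>cos (\<gamma> + \<theta> s) = 0\<close>, the addition theorem leaves one term, with constant sign \<open>\<sigma>\<close>.\<close>
  have cosd: "cos (\<gamma> + \<theta> t) = \<sigma> * sin (\<delta> t)" for t
  proof -
    have "\<gamma> + \<theta> t = (\<gamma> + \<theta> s) + \<delta> t" by (simp add: \<delta>_def)
    thus ?thesis using cos0 by (simp only: cos_add[of "\<gamma> + \<theta> s"] \<sigma>_def)
  qed
  have \<sigma>2: "\<sigma> * \<sigma> = 1"
    using cos0 sin_cos_squared_add[of "\<gamma> + \<theta> s"] by (simp add: \<sigma>_def power2_eq_square)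
  define u where "u t = \<sigma> * Im (c * F (of_real \<rho> * cis t))" for t
  have du: "(u has_real_derivative A t * sin (\<delta> t)) (at t)" for t
  proof -
    have "((\<lambda>t. c * F (of_real \<rho> * cis t)) has_vector_derivative
            c * (\<i> * (of_real \<rho> * cis t * deriv F (of_real \<rho> * cis t)))) (at t)"
      using z0 by (intro has_vector_derivative_mult_right has_vector_derivative_on_circle[OF F]) auto
    hence "((\<lambda>t. Im (c * F (of_real \<rho> * cis t))) has_real_derivative
             Im (c * (\<i> * (of_real \<rho> * cis t * deriv F (of_real \<rho> * cis t))))) (at t)"
      by (simp add: has_vector_derivative_complex_iff)
    moreover have "Im (c * (\<i> * x)) = Re (c * x)" for x by (simp add: algebra_simps)
    ultimately have "((\<lambda>t. Im (c * F (of_real \<rho> * cis t))) has_real_derivative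
             A t * (\<sigma> * sin (\<delta> t))) (at t)" by (simp only: tang cosd)
    hence "(u has_real_derivative \<sigma> * (A t * (\<sigma> * sin (\<delta> t)))) (at t)"
      unfolding u_def by (rule DERIV_cmult)
    moreover have "\<sigma> * (A t * (\<sigma> * sin (\<delta> t))) = (\<sigma> * \<sigma>) * (A t * sin (\<delta> t))" by (simp only: ac_simps)
    ultimately show ?thesis by (simp add: \<sigma>2)
  qed
  have incr: "\<delta> a \<le> \<delta> b" if "a \<le> b" for a b
  proof -
    have "\<theta> a \<le> \<theta> b" unfolding \<theta>_def
    proof (rule DERIV_nonneg_imp_nondecreasing[OF that])
      fix x
      show "\<exists>y. (circle_angle L \<rho> has_real_derivative y) (at x) \<and> 0 \<le> y"
        using circle_angle_deriv[OF L, of \<rho> x] pos[OF inb, of x] z0 by auto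
    qed
    thus ?thesis by (simp add: \<delta>_def)
  qed
  have \<delta>s: "\<delta> s = 0" "\<delta> (s + 2 * pi) = 2 * pi" by (auto simp: \<delta>_def \<theta>_def circle_angle_periodic)
  have us: "u (s + 2 * pi) = u s" by (simp add: u_def flip: cis_mult)
  have min: "u s \<le> u t" if t: "s \<le> t" "t \<le> s + 2 * pi" for t
  proof (cases "\<delta> t \<le> pi")
    case True
    show ?thesis
    proof (rule DERIV_nonneg_imp_nondecreasing[OF t(1)])
      fix x assume "s \<le> x" "x \<le> t"
      hence "0 \<le> \<delta> x" "\<delta> x \<le> pi" using incr[of s x] incr[of x t] True \<delta>s by auto
      thus "\<exists>y. (u has_real_derivative y) (at x) \<and> 0 \<le> y"
        using du[of x] A[of x] by (intro exI[of _ "A x * sin (\<delta> x)"]) (auto intro!: mult_nonneg_nonneg sin_ge_zero)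
    qed
  next
    case False
    have "u (s + 2 * pi) \<le> u t"
    proof (rule DERIV_nonpos_imp_nonincreasing[OF t(2)])
      fix x assume "t \<le> x" "x \<le> s + 2 * pi"
      hence "pi \<le> \<delta> x" "\<delta> x \<le> 2 * pi" using incr[of t x] incr[of x "s + 2 * pi"] False \<delta>s by auto
      hence "sin (\<delta> x) \<le> 0" using sin_ge_zero[of "\<delta> x - pi"] by simp
      thus "\<exists>y. (u has_real_derivative y) (at x) \<and> y \<le> 0"
        using du[of x] A[of x] by (intro exI[of _ "A x * sin (\<delta> x)"]) (auto intro!: mult_nonneg_nonpos)
    qed
    thus ?thesis using us by simp
  qed
  have all: "\<sigma> * Im (c * F z0) \<le> \<sigma> * Im (c * F z)" if z: "norm z = \<rho>" for z
  proof -
    define d where "d = Arg2pi (z / z0)"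
    have "z / z0 = cis d"
      using Arg2pi_eq[of "z / z0"] z z0 by (simp add: d_def cis_conv_exp norm_divide)
    moreover have "z0 \<noteq> 0" using z0 by auto
    ultimately have "z = of_real \<rho> * cis (s + d)" by (simp add: field_simps z0s flip: cis_mult)
    moreover have "0 \<le> d" "d < 2 * pi" using Arg2pi[of "z / z0"] by (auto simp: d_def)
    ultimately show ?thesis using min[of "s + d"] by (simp add: u_def z0s)
  qed
  have "\<sigma> = 1 \<or> \<sigma> = -1" using \<sigma>2 by (simp add: square_eq_1_iff)
  thus ?thesis using all by fastforce
qed auto

section \<open>From analytic functions to harmonic maps\<close>

lemma log_of_zerofree_on_ball:
  fixes f :: "complex \<Rightarrow> complex"
  assumes "R > 0" "f holomorphic_on ball 0 R" "\<And>z. z \<in> ball 0 R \<Longrightarrow> f z \<noteq> 0"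
  obtains L where "L holomorphic_on ball 0 R" "\<And>z. z \<in> ball 0 R \<Longrightarrow> exp (L z) = f z"
    "\<And>z. z \<in> ball 0 R \<Longrightarrow> deriv L z = deriv f z / f z"
proof -
  have "convex (ball (0::complex) R)" "(0::complex) \<in> ball 0 R" using assms(1) by auto
  then obtain L where L: "L holomorphic_on ball 0 R" "\<And>z. z \<in> ball 0 R \<Longrightarrow> exp (L z) = f z"
    using holomorphic_logarithm_exists[OF _ open_ball assms(2)] assms(3) by metis
  have "deriv L z = deriv f z / f z" if z: "z \<in> ball 0 R" for z
  proof -
    have "((\<lambda>z. exp (L z)) has_field_derivative exp (L z) * deriv L z) (at z)"
      using holomorphic_derivI[OF L(1) open_ball z] by (auto intro!: derivative_eq_intros)
    hence "(f has_field_derivative exp (L z) * deriv L z) (at z)"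
      by (rule has_field_derivative_transform_within_open[where S = "ball 0 R"]) (use z L(2) in auto)
    hence "deriv f z = exp (L z) * deriv L z" by (rule DERIV_imp_deriv)
    thus ?thesis using L(2)[OF z] assms(3)[OF z] by (simp add: field_simps)
  qed
  thus ?thesis using L that by blast
qed

text \<open>The condition on the derivatives says that the Jacobian of \<open>h + cnj g\<close> is positive.\<close>
locale harmonic_ball =
  fixes h g :: "complex \<Rightarrow> complex" and R :: real
  assumes h: "h holomorphic_on ball 0 R" and g: "g holomorphic_on ball 0 R"
    and sense: "\<And>z. z \<in> ball 0 R \<Longrightarrow> norm (deriv g z) < norm (deriv h z)"
begin

definition f where "f z = h z + cnj (g z)"

lemma f_open:
  assumes T: "open T" "T \<subseteq> ball 0 R"
  shows "open (f ` T)"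
proof -
  have cont: "continuous_on (ball 0 R) f"
    unfolding f_def using h g by (intro continuous_intros holomorphic_on_imp_continuous_on)
  have "f x \<in> interior (f ` T)" if x: "x \<in> T" for x
  proof (rule sussmann_open_mapping[OF open_ball cont])
    have xR: "x \<in> ball 0 R" using x T by blast
    show "x \<in> ball 0 R" by (rule xR)
    define p where "p = deriv h x"
    define q where "q = deriv g x"
    define J where "J = p * cnj p - q * cnj q"
    have Jr: "J = of_real ((norm p)\<^sup>2 - (norm q)\<^sup>2)" by (simp add: J_def complex_norm_square del: of_real_power)
    have "(norm q)\<^sup>2 < (norm p)\<^sup>2" using sense[OF xR] by (intro power_strict_mono) (auto simp: p_def q_def)
    hence "(norm p)\<^sup>2 - (norm q)\<^sup>2 \<noteq> 0" by linarith
    hence "J \<noteq> 0" unfolding Jr by (simp only: of_real_eq_0_iff not_False_eq_True)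
    moreover have "cnj J = J" unfolding Jr by (rule complex_cnj_complex_of_real)
    ultimately have J: "J \<noteq> 0" "cnj J = J" by auto
    show "(f has_derivative (\<lambda>v. p * v + cnj (q * v))) (at x)"
      unfolding f_def p_def q_def
      using holomorphic_derivI[OF h open_ball xR] holomorphic_derivI[OF g open_ball xR]
      by (intro has_derivative_add has_derivative_cnj) (auto simp: has_field_derivative_def)
    show "bounded_linear (\<lambda>y. (cnj p * y - cnj (q * y)) / J)"
      by (intro bounded_linear_divide[THEN bounded_linear_compose] bounded_linear_sub bounded_linear_mult_right
           bounded_linear_cnj[THEN bounded_linear_compose])
    show "(\<lambda>v. p * v + cnj (q * v)) \<circ> (\<lambda>y. (cnj p * y - cnj (q * y)) / J) = id"
    proof
      fix y
      have "p * ((cnj p * y - cnj (q * y)) / J) + cnj (q * ((cnj p * y - cnj (q * y)) / J)) = 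
         (p * (cnj p * y - cnj (q * y)) + cnj q * (p * cnj y - q * y)) / J"
        using J by (simp add: add_divide_distrib)
      also have "\<dots> = (J * y) / J" by (simp add: J_def algebra_simps)
      finally show "((\<lambda>v. p * v + cnj (q * v)) \<circ> (\<lambda>y. (cnj p * y - cnj (q * y)) / J)) y = id y"
        using J by simp
    qed
  qed (use T x in \<open>auto simp: interior_open\<close>)
  thus ?thesis by (metis imageE open_subopen interior_subset open_interior)
qed

lemma compact_image: "r < R \<Longrightarrow> compact (f ` cball 0 r)"
  unfolding f_def
  by (intro compact_continuous_image continuous_intros holomorphic_on_imp_continuous_on
        holomorphic_on_subset[OF h] holomorphic_on_subset[OF g]) auto

text \<open>The map is open, so the image of the open disk lies in the interior.\<close>
lemma frontier_image:
  assumes "r < R" shows "frontier (f ` cball 0 r) \<subseteq> f ` sphere 0 r"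
proof -
  have "open (f ` ball 0 r)" using assms by (intro f_open) auto
  hence int: "f ` ball 0 r \<subseteq> interior (f ` cball 0 r)" by (intro interior_maximal image_mono) auto
  have "frontier (f ` cball 0 r) = f ` cball 0 r - interior (f ` cball 0 r)"
    using compact_image[OF assms] by (simp add: frontier_def compact_imp_closed)
  also have "\<dots> \<subseteq> f ` cball 0 r - f ` ball 0 r" by (rule Diff_mono[OF order_refl int])
  also have "\<dots> \<subseteq> f ` (cball 0 r - ball 0 r)" by (rule image_diff_subset)
  also have "cball 0 r - ball 0 r = sphere (0::complex) r" by (rule cball_diff_eq_sphere)
  finally show ?thesis .
qed

lemma image_ball_eq: "f ` ball 0 R = (\<Union>r\<in>{0<..<R}. f ` cball 0 r)"
proof -
  have "ball 0 R = (\<Union>r\<in>{0<..<R}. cball 0 r :: complex set)"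
  proof (intro equalityI subsetI)
    fix z :: complex assume "z \<in> ball 0 R"
    then obtain r where "norm z < r" "r < R" using dense by auto
    moreover have "0 < r" using norm_ge_zero[of z] calculation by linarith
    ultimately show "z \<in> (\<Union>r\<in>{0<..<R}. cball 0 r)"
      by (intro UN_I[of r]) auto
  qed auto
  thus ?thesis by (simp add: image_UN)
qed

lemma domain_image:
  assumes "R > 0" shows "domain_in_plane (f ` ball 0 R)"
proof -
  have "connected (f ` ball 0 R)"
    unfolding f_def
    by (intro connected_continuous_image continuous_intros holomorphic_on_imp_continuous_on h g) auto
  thus ?thesis using f_open[of "ball 0 R"] assms by (auto simp: domain_in_plane_def)
qed

text \<open>If all the analytic functions \<open>h + e * g\<close> with \<open>norm e = 1\<close> are convex, so is \<open>h + cnj g\<close>. The reason is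
  \<open>Im (cnj e * (h + cnj g)) = Im (cnj e * (h - e\<^sup>2 * g))\<close>: the height of the harmonic curve in a given direction
  is also the height of an analytic convex curve in that direction. At a boundary point, choosing \<open>e\<close> tangent to
  the harmonic curve makes this height critical, hence extremal, which gives a supporting line.\<close>
lemma convex_image:
  assumes conv: "\<And>e z. norm e = 1 \<Longrightarrow> z \<in> ball 0 R \<Longrightarrow> 
      Re (1 + z * deriv (deriv (\<lambda>z. h z + e * g z)) z / deriv (\<lambda>z. h z + e * g z) z) \<ge> 0"
  shows "convex (f ` ball 0 R)"
proof -
  have conv_r: "convex (f ` cball 0 r)" if r: "0 < r" "r < R" for r
  proof (rule convex_if_frontier_supported[OF compact_image[OF r(2)] _ frontier_image[OF r(2)]])
    have "f ` ball 0 r \<subseteq> interior (f ` cball 0 r)" 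
      using r by (intro interior_maximal image_mono f_open) auto
    thus "interior (f ` cball 0 r) \<noteq> {}" using r by force
    fix p assume "p \<in> f ` sphere 0 r"
    then obtain z0 where z0: "norm z0 = r" "p = f z0" by auto
    have z0R: "z0 \<in> ball 0 R" using z0 r by simp
    define D where "D = z0 * deriv h z0 - cnj (z0 * deriv g z0)"
    \<comment> \<open>The derivative of \<open>f\<close> along the circle is \<open>\<i> * D\<close>, so \<open>e\<close> is a unit tangent vector.\<close>
    define e where "e = (if D = 0 then 1 else \<i> * sgn D)"
    have e: "norm e = 1" by (simp add: e_def norm_mult norm_sgn)
    have ee: "cnj e * e = 1" using e by (metis complex_norm_square mult.commute of_real_1 power_one)
    have eD: "Re (cnj e * D) = 0"
    proof (cases "D = 0")
      case False
      have "cnj e * D = - \<i> * of_real (norm D)"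
        using False by (simp add: e_def sgn_eq field_simps complex_norm_square[symmetric] power2_eq_square flip: of_real_mult)
      thus ?thesis by simp
    qed simp
    define F where "F z = h z + (- e\<^sup>2) * g z" for z
    have F: "F holomorphic_on ball 0 R" unfolding F_def by (intro holomorphic_intros h g)
    have dF: "deriv F z = deriv h z - e\<^sup>2 * deriv g z" if "z \<in> ball 0 R" for z
      unfolding F_def using holomorphic_derivI[OF h open_ball that] holomorphic_derivI[OF g open_ball that]
      by (intro DERIV_imp_deriv) (auto intro!: derivative_eq_intros)
    have dF0: "deriv F z \<noteq> 0" if "z \<in> ball 0 R" for z
    proof
      assume "deriv F z = 0"
      hence "norm (deriv h z) = norm (e\<^sup>2 * deriv g z)" unfolding dF[OF that] by simp
      thus False using sense[OF that] e by (simp add: norm_mult norm_power)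
    qed
    obtain L where L: "L holomorphic_on ball 0 R" "\<And>z. z \<in> ball 0 R \<Longrightarrow> exp (L z) = deriv F z"
      "\<And>z. z \<in> ball 0 R \<Longrightarrow> deriv L z = deriv (deriv F) z / deriv F z"
      using log_of_zerofree_on_ball[OF order.strict_trans[OF r] holomorphic_deriv[OF F open_ball] dF0] by metis
    have "Re (1 + z * deriv L z) \<ge> 0" if "z \<in> ball 0 R" for z
      using conv[of "- e\<^sup>2", OF _ that] e L(3)[OF that] by (simp add: F_def[abs_def] norm_power)
    moreover have "Re (cnj e * (z0 * deriv F z0)) = 0"
    proof -
      have "cnj e * (z0 * deriv F z0) = cnj e * (z0 * deriv h z0) - (cnj e * e) * (e * (z0 * deriv g z0))"
        unfolding dF[OF z0R] by (simp add: power2_eq_square algebra_simps)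
      hence "Re (cnj e * (z0 * deriv F z0)) = Re (cnj e * (z0 * deriv h z0)) - Re (e * (z0 * deriv g z0))"
        by (simp only: ee mult_1 minus_complex.sel)
      also have "\<dots> = Re (cnj e * D)"
        by (simp add: D_def algebra_simps)
      finally show ?thesis using eD by simp
    qed
    ultimately have supp: "(\<forall>z. norm z = r \<longrightarrow> Im (cnj e * F z) \<le> Im (cnj e * F z0)) \<or>
         (\<forall>z. norm z = r \<longrightarrow> Im (cnj e * F z0) \<le> Im (cnj e * F z))"
      using L(2) z0(1) r by (intro circle_image_supported_at_critical_direction[OF F L(1)]) auto
    have eF: "Im (cnj e * F z) = (\<i> * e) \<bullet> f z" for z
    proof -
      have "cnj e * F z = cnj e * h z - (cnj e * e) * (e * g z)"
        by (simp add: F_def power2_eq_square algebra_simps)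
      hence "Im (cnj e * F z) = Im (cnj e * h z) - Im (e * g z)" by (simp add: ee)
      also have "\<dots> = (\<i> * e) \<bullet> f z" by (simp add: f_def inner_complex_def algebra_simps)
      finally show ?thesis .
    qed
    have "\<i> * e \<noteq> 0" using e by auto
    with supp show "\<exists>n. n \<noteq> 0 \<and> (\<forall>y\<in>f ` sphere 0 r. n \<bullet> y \<le> n \<bullet> p)"
      unfolding eF z0(2) 
      by (elim disjE; intro exI[of _ "\<i> * e"] exI[of _ "- (\<i> * e)"]) auto
  qed
  show ?thesis
    unfolding convex_contains_segment
  proof (intro ballI)
    fix x y assume "x \<in> f ` ball 0 R" "y \<in> f ` ball 0 R"
    then obtain r s where rs: "r \<in> {0<..<R}" "s \<in> {0<..<R}" "x \<in> f ` cball 0 r" "y \<in> f ` cball 0 s"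
      unfolding image_ball_eq by (elim UN_E)
    define m where "m = max r s"
    have m: "0 < m" "m < R" "r \<le> m" "s \<le> m" using rs by (auto simp: m_def)
    have "x \<in> f ` cball 0 m" "y \<in> f ` cball 0 m"
      by (rule subsetD[OF image_mono[OF subset_cball] rs(3)] subsetD[OF image_mono[OF subset_cball] rs(4)], rule m)+
    hence "closed_segment x y \<subseteq> f ` cball 0 m" by (intro closed_segment_subset conv_r m)
    moreover have "f ` cball 0 m \<subseteq> f ` ball 0 R" using m by (intro image_mono) auto
    ultimately show "closed_segment x y \<subseteq> f ` ball 0 R" by (rule order_trans)
  qed
qed

text \<open>If all \<open>F = h + e * g\<close> with \<open>norm e \<le> 1\<close> are starlike, so is \<open>f = h + cnj g\<close>. The hypothesis for all \<open>e\<close> in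
  the closed disk forces \<open>norm (g z) < norm (h z)\<close> away from the origin. If \<open>f z\<close> lies on the ray of a point
  \<open>p\<close>, then \<open>h - (p / cnj p) * g\<close> takes at \<open>z\<close> the value
  \<open>((norm h)\<^sup>2 - (norm g)\<^sup>2) / (norm f)\<^sup>2 * f z\<close>, which is on the same ray. So a ray that met the image of a
  circle under \<open>f\<close> twice would meet the image of this circle under one starlike \<open>F\<close> twice.\<close>
lemma starlike_image:
  assumes R: "R > 0" and 0: "h 0 = 0" "g 0 = 0"
    and star: "\<And>e z. norm e \<le> 1 \<Longrightarrow> z \<in> ball 0 R \<Longrightarrow> z \<noteq> 0 \<Longrightarrow> 
      Re (z * deriv (\<lambda>z. h z + e * g z) z / (h z + e * g z)) > 0"
  shows "starlike_domain (f ` ball 0 R)"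
proof -
  have f0: "f 0 = 0" by (simp add: f_def 0)
  have less: "norm (g z) < norm (h z)" if z: "z \<in> ball 0 R" "z \<noteq> 0" for z
  proof (rule ccontr)
    assume not: "\<not> norm (g z) < norm (h z)"
    have "h z \<noteq> 0" using star[of 0, OF _ z] by auto
    hence gz: "g z \<noteq> 0" using not by auto
    \<comment> \<open>With this coefficient \<open>h + e * g\<close> would vanish at \<open>z\<close>.\<close>
    have "norm (- (h z / g z)) \<le> 1" using not gz by (simp add: norm_divide)
    from star[OF this z] show False using gz by simp
  qed
  have fnz: "f z \<noteq> 0" if "z \<in> ball 0 R" "z \<noteq> 0" for z
  proof
    assume "f z = 0"
    hence "norm (h z) = norm (- cnj (g z))" unfolding f_def by (metis add_eq_0_iff2)
    thus False using less[OF that] by simp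
  qed
  have ray: "c = 1" if r: "0 < r" "r < R" and p: "p \<in> f ` sphere 0 r" "c *\<^sub>R p \<in> f ` sphere 0 r" and c: "c > 0" for r p c
  proof -
    obtain z1 where z1: "norm z1 = r" "p = f z1" using p by auto
    obtain z2 where z2: "norm z2 = r" "c *\<^sub>R p = f z2" using p(2) by auto
    have zR: "z1 \<in> ball 0 R" "z2 \<in> ball 0 R" "z1 \<noteq> 0" "z2 \<noteq> 0" using z1 z2 r by auto
    define e where "e = p / cnj p"
    have pnz: "p \<noteq> 0" using fnz[of z1] zR z1 by simp
    have e: "norm e = 1" using pnz by (simp add: e_def norm_divide)
    define F where "F z = h z + (- e) * g z" for z
    have F: "F holomorphic_on ball 0 R" unfolding F_def by (intro holomorphic_intros h g)
    have F0: "F 0 = 0" by (simp add: F_def 0)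
    have Fz: "F z = of_real (((norm (h z))\<^sup>2 - (norm (g z))\<^sup>2) / (norm (f z))\<^sup>2) * f z"
      if z: "z \<in> ball 0 R" "z \<noteq> 0" and ez: "e = f z / cnj (f z)" for z
    proof -
      have nz: "f z \<noteq> 0" using fnz z by blast
      have "F z * cnj (f z) = h z * cnj (f z) - f z * g z"
        using nz by (simp add: F_def ez field_simps)
      also have "\<dots> = of_real ((norm (h z))\<^sup>2 - (norm (g z))\<^sup>2)"
        by (simp add: f_def complex_norm_square algebra_simps del: of_real_power)
      finally have 1: "F z = of_real ((norm (h z))\<^sup>2 - (norm (g z))\<^sup>2) / cnj (f z)" using nz by (simp add: field_simps)
      have "f z / of_real ((norm (f z))\<^sup>2) = 1 / cnj (f z)" using nz by (simp add: complex_norm_square del: of_real_power)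
      hence "of_real ((norm (h z))\<^sup>2 - (norm (g z))\<^sup>2) * (f z / of_real ((norm (f z))\<^sup>2)) =
          of_real ((norm (h z))\<^sup>2 - (norm (g z))\<^sup>2) * (1 / cnj (f z))" by (simp only:)
      thus ?thesis unfolding 1 of_real_divide by (simp only: times_divide_eq_right times_divide_eq_left mult_1_right)
    qed
    define a where "a z = ((norm (h z))\<^sup>2 - (norm (g z))\<^sup>2) / (norm (f z))\<^sup>2" for z
    have a: "a z > 0" if "z \<in> ball 0 R" "z \<noteq> 0" for z
      using less[OF that] fnz[OF that] by (auto simp: a_def intro!: divide_pos_pos power_strict_mono)
    have F1: "F z1 = of_real (a z1) * p"
      using Fz[OF zR(1,3)] z1 by (simp add: e_def a_def)
    have "e = f z2 / cnj (f z2)" unfolding z2(2)[symmetric] using c by (simp add: e_def scaleR_conv_of_real)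
    hence F2: "F z2 = of_real (a z2) * (of_real c * p)"
      using Fz[OF zR(2,4)] by (simp add: a_def scaleR_conv_of_real flip: z2(2))
    obtain k where k: "k holomorphic_on ball 0 R" "\<And>z. z \<in> ball 0 R \<Longrightarrow> F z = z * k z"
      using Schwarz3[OF F F0] by (metis mem_ball_0)
    have starF: "Re (z * deriv F z / F z) > 0" if "z \<in> ball 0 R" "z \<noteq> 0" for z
      using star[of "-e" z] that e by (simp add: F_def[abs_def])
    have dF: "deriv F z = k z + z * deriv k z" if z: "z \<in> ball 0 R" for z
    proof -
      have "((\<lambda>z. z * k z) has_field_derivative (k z + z * deriv k z)) (at z)"
        using holomorphic_derivI[OF k(1) open_ball z] by (auto intro!: derivative_eq_intros)
      hence "(F has_field_derivative (k z + z * deriv k z)) (at z)"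
        by (rule has_field_derivative_transform_within_open[where S = "ball 0 R"]) (use z k(2) in auto)
      thus ?thesis by (rule DERIV_imp_deriv)
    qed
    have knz: "k z \<noteq> 0" if z: "z \<in> ball 0 R" for z
    proof (cases "z = 0")
      case True
      have "deriv F 0 = deriv h 0 - e * deriv g 0"
        unfolding F_def using holomorphic_derivI[OF h open_ball, of 0] holomorphic_derivI[OF g open_ball, of 0] R
        by (intro DERIV_imp_deriv) (auto intro!: derivative_eq_intros)
      hence "k 0 = deriv h 0 - e * deriv g 0" using dF[of 0] R by simp
      moreover have "norm (e * deriv g 0) < norm (deriv h 0)" using sense[of 0] R e by (simp add: norm_mult)
      ultimately show ?thesis using True by auto
    next
      case False
      thus ?thesis using starF[OF z] k(2)[OF z] by auto
    qed
    obtain L where L: "L holomorphic_on ball 0 R" "\<And>z. z \<in> ball 0 R \<Longrightarrow> exp (L z) = k z"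
      "\<And>z. z \<in> ball 0 R \<Longrightarrow> deriv L z = deriv k z / k z"
      using log_of_zerofree_on_ball[OF R k(1) knz] by metis
    have "z1 = z2"
    proof (rule ray_meets_circle_image_once[OF L(1) _ z1(1) z2(1) r, of "a z2 * c / a z1"])
      show "Re (1 + z * deriv L z) > 0" if z: "z \<in> ball 0 R" for z
      proof (cases "z = 0")
        case False
        have "z * deriv F z / F z = 1 + z * deriv L z"
          unfolding dF[OF z] k(2)[OF z] L(3)[OF z] using False knz[OF z] by (simp add: field_simps)
        thus ?thesis using starF[OF z False] by simp
      qed simp
      show "0 < a z2 * c / a z1" using a zR c by simp
      have "z2 * exp (L z2) = F z2" "z1 * exp (L z1) = F z1" using k(2) L(2) zR by auto
      moreover have "a z1 \<noteq> 0" using a[OF zR(1,3)] by simp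
      ultimately show "z2 * exp (L z2) = of_real (a z2 * c / a z1) * (z1 * exp (L z1))"
        by (simp add: F1 F2)
    qed
    hence "c *\<^sub>R p = 1 *\<^sub>R p" using z1 z2 by simp
    thus "c = 1" using pnz unfolding scaleR_cancel_right by simp
  qed
  have "closed_segment 0 w \<subseteq> f ` ball 0 R" if w: "w \<in> f ` ball 0 R" for w
  proof -
    obtain r where r: "0 < r" "r < R" "w \<in> f ` cball 0 r" using w unfolding image_ball_eq by auto
    have "0 \<in> f ` cball 0 r" using f0 r by (intro image_eqI[of _ _ 0]) auto
    moreover have "0 \<notin> f ` sphere 0 r" using fnz r by force
    ultimately have "closed_segment 0 w \<subseteq> f ` cball 0 r"
      using ray[OF r(1,2)]
      by (intro segments_from_0_if_frontier_meets_rays_once[OF _ _ frontier_image[OF r(2)]] compact_imp_closed compact_image r)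
    moreover have "f ` cball 0 r \<subseteq> f ` ball 0 R" using r by (intro image_mono) auto
    ultimately show ?thesis by (rule order_trans)
  qed
  moreover have "0 \<in> f ` ball 0 R" using f0 R by (intro image_eqI[of _ _ 0]) auto
  ultimately show ?thesis using domain_image[OF R] by (auto simp: starlike_domain_def)
qed

end

section \<open>Lower bounds through averages of kernels\<close>

text \<open>This transfers a lower bound on a real-linear functional from a family of functions \<open>\<psi> t\<close> to their averages
  \<open>\<phi>\<close>, in the sense of a probability density \<open>w\<close>. Only the interchange of two integrals is involved.\<close>
lemma average_preserves_lower_bound:
  fixes c :: "real \<Rightarrow> complex" and \<psi> :: "real \<Rightarrow> real \<Rightarrow> complex" and w :: "real \<Rightarrow> real"
  assumes c: "continuous_on {0..1} c" and \<psi>: "continuous_on ({0..1} \<times> {0..1}) (\<lambda>(t, s). \<psi> t s)"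
    and w: "continuous_on {0..1} w" "\<And>t. t \<in> {0..1} \<Longrightarrow> w t \<ge> 0" "(w has_integral 1) {0..1}"
    and \<phi>: "\<And>s. s \<in> {0..1} \<Longrightarrow> ((\<lambda>t. of_real (w t) * \<psi> t s) has_integral \<phi> s) {0..1}"
    and lb: "\<And>t. t \<in> {0..1} \<Longrightarrow> \<delta> \<le> Re (integral {0..1} (\<lambda>s. c s * \<psi> t s))"
  shows "\<delta> \<le> Re (integral {0..1} (\<lambda>s. c s * \<phi> s))"
proof -
  define I where "I t = integral {0..1} (\<lambda>s. c s * \<psi> t s)" for t
  have c\<psi>: "continuous_on ({0..1} \<times> {0..1}) (\<lambda>(t, s). c s * \<psi> t s)"
  proof -
    have "continuous_on ({0..1} \<times> {0..1}) (\<lambda>x :: real \<times> real. c (snd x))"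
      by (intro continuous_on_compose2[OF c] continuous_intros) auto
    from continuous_on_mult[OF this \<psi>] show ?thesis by (simp add: case_prod_unfold)
  qed
  have wc\<psi>: "continuous_on ({0..1} \<times> {0..1}) (\<lambda>(t, s). of_real (w t) * (c s * \<psi> t s))"
  proof -
    have "continuous_on ({0..1} \<times> {0..1}) (\<lambda>x :: real \<times> real. complex_of_real (w (fst x)))"
      by (intro continuous_on_of_real continuous_on_compose2[OF w(1)] continuous_intros) auto
    from continuous_on_mult[OF this c\<psi>] show ?thesis by (simp add: case_prod_unfold)
  qed
  have I: "continuous_on {0..1} I"
    using integral_continuous_on_param[of "{0..1}" 0 1 "\<lambda>t s. c s * \<psi> t s"] c\<psi> by (simp add: I_def[abs_def])
  have "integral {0..1} (\<lambda>s. c s * \<phi> s) = integral {0..1} (\<lambda>s. integral {0..1} (\<lambda>t. of_real (w t) * (c s * \<psi> t s)))"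
  proof (rule integral_cong)
    fix s :: real assume "s \<in> {0..1}"
    from has_integral_mult_right[OF \<phi>[OF this], of "c s"]
    show "c s * \<phi> s = integral {0..1} (\<lambda>t. of_real (w t) * (c s * \<psi> t s))"
      by (intro integral_unique[symmetric]) (simp add: mult_ac)
  qed
  also have "\<dots> = integral {0..1} (\<lambda>t. integral {0..1} (\<lambda>s. of_real (w t) * (c s * \<psi> t s)))"
    using integral_swap_continuous[of 0 0 1 1 "\<lambda>t s. of_real (w t) * (c s * \<psi> t s)"] wc\<psi>
    by (simp add: cbox_Pair_eq)
  also have "\<dots> = integral {0..1} (\<lambda>t. of_real (w t) * I t)"
    by (simp add: I_def)
  finally have eq: "integral {0..1} (\<lambda>s. c s * \<phi> s) = integral {0..1} (\<lambda>t. of_real (w t) * I t)" .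
  have "(\<lambda>t. of_real (w t) * I t) integrable_on {0..1}"
    using w(1) I by (intro integrable_continuous_real continuous_intros)
  hence "((\<lambda>t. Re (of_real (w t) * I t)) has_integral Re (integral {0..1} (\<lambda>t. of_real (w t) * I t))) {0..1}"
    by (intro has_integral_linear[OF _ bounded_linear_Re, unfolded o_def] integrable_integral)
  moreover have "((\<lambda>t. w t * \<delta>) has_integral 1 * \<delta>) {0..1}"
    by (intro has_integral_mult_left w)
  ultimately have "1 * \<delta> \<le> Re (integral {0..1} (\<lambda>t. of_real (w t) * I t))"
    using lb w(2) by (intro has_integral_le[of "\<lambda>t. w t * \<delta>" "1 * \<delta>"]) (auto simp: I_def intro!: mult_left_mono)
  thus ?thesis by (simp add: eq)
qed

lemma norm_convex_comb_le:
  fixes u v :: complex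
  assumes "norm u \<le> r" "norm v \<le> r" "t \<in> {0..1}"
  shows "norm (of_real t * u + of_real (1 - t) * v) \<le> r"
proof -
  have "norm (of_real t * u + of_real (1 - t) * v) \<le> t * norm u + (1 - t) * norm v"
    using norm_triangle_ineq[of "of_real t * u" "of_real (1 - t) * v"] assms(3) by (simp add: norm_mult del: of_real_diff)
  also have "\<dots> \<le> r" using assms by (intro convex_bound_le) auto
  finally show ?thesis .
qed

lemma one_minus_mult_nz:
  fixes u :: complex
  assumes "norm u \<le> r" "r < 1" "s \<in> {0..1}"
  shows "1 - u * of_real s \<noteq> 0"
proof
  assume "1 - u * of_real s = 0"
  hence "norm (u * of_real s) = 1" by simp
  moreover have "norm u * \<bar>s\<bar> \<le> norm u * 1" using assms by (intro mult_left_mono) auto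
  ultimately show False using assms by (simp add: norm_mult)
qed

text \<open>Half the minimum over real \<open>x\<close> of the quadratic \<open>2 * x\<^sup>2 - x * (1 + r) / (1 - r) + 1 / (1 - r)\<close>. The
  discriminant has the sign of \<open>r\<^sup>2 + 10 * r - 7\<close>, whose positive root is \<open>4 * sqrt 2 - 5\<close>.\<close>
definition kernel_margin :: "real \<Rightarrow> real" where "kernel_margin r = (1 / (1 - r) - ((1 + r) / (1 - r))\<^sup>2 / 8) / 2"

lemma kernel_margin_pos:
  assumes "0 \<le> r" "r < 4 * sqrt 2 - 5" shows "kernel_margin r > 0"
proof -
  have "(r + 5)\<^sup>2 < (4 * sqrt 2)\<^sup>2" using assms by (intro power_strict_mono) auto
  also have "(4 * sqrt 2)\<^sup>2 = 32" by (simp add: power_mult_distrib)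
  finally have *: "(1 + r)\<^sup>2 < 8 * (1 - r)" by (simp add: power2_eq_square algebra_simps)
  have "r < 1" using le_less_trans[OF zero_le_power2 *] by simp
  have "((1 + r) / (1 - r))\<^sup>2 / 8 = (1 + r)\<^sup>2 / (8 * (1 - r)) / (1 - r)" using \<open>r < 1\<close> by (simp add: field_simps power2_eq_square)
  also have "\<dots> < 1 / (1 - r)" using * \<open>r < 1\<close> by (intro divide_strict_right_mono) (auto simp: field_simps)
  finally show ?thesis by (simp add: kernel_margin_def)
qed

text \<open>The extremal case, and the place where the starlikeness radius comes from. With \<open>v = 1 / (1 - u)\<close> the
  integral is \<open>(v\<^sup>2 + v - m * v\<^sup>2) / 2\<close>, and \<open>v\<close> ranges over the disk \<open>norm (v - 1) \<le> r * norm v\<close>.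
  Eliminating \<open>Im v\<close> with the equation of this disk leaves the quadratic in \<open>Re v\<close> from the definition of
  \<^const>\<open>kernel_margin\<close>.\<close>
lemma kernel_bound_cube:
  assumes u: "norm u \<le> r" and m: "norm m \<le> r" and r: "r < 1"
  shows "kernel_margin r \<le> Re (integral {0..1} (\<lambda>s. (1 - m * of_real s) * (1 / (1 - u * of_real s) ^ 3)))"
proof -
  define v where "v = 1 / (1 - u)"
  have "u \<noteq> 1" using u r by auto
  have r0: "0 \<le> r" using norm_ge_zero[of u] u by linarith
  define E where "E s = (2 * of_real s - u * of_real s ^ 2 - m * of_real s ^ 2) / (2 * (1 - u * of_real s)\<^sup>2)" for s :: real
  have "((\<lambda>s. (1 - m * of_real s) * (1 / (1 - u * of_real s) ^ 3)) has_integral E 1 - E 0) {0..1}"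
  proof (rule fundamental_theorem_of_calculus)
    fix s :: real assume s: "s \<in> {0..1}"
    have nz: "1 - u * of_real s \<noteq> 0" by (rule one_minus_mult_nz[OF u r s])
    have "((\<lambda>z. (2 * z - u * z ^ 2 - m * z ^ 2) / (2 * (1 - u * z)\<^sup>2)) has_field_derivative
            (1 - m * of_real s) * (1 / (1 - u * of_real s) ^ 3)) (at (of_real s))"
      using nz by (auto intro!: derivative_eq_intros simp: divide_simps) algebra
    from has_vector_derivative_real_field[OF this]
    show "(E has_vector_derivative (1 - m * of_real s) * (1 / (1 - u * of_real s) ^ 3)) (at s within {0..1})"
      unfolding E_def by (rule has_vector_derivative_at_within)
  qed simp
  moreover have "E 1 - E 0 = (v\<^sup>2 + v - m * v\<^sup>2) / 2"
    using \<open>u \<noteq> 1\<close> by (simp add: E_def v_def divide_simps) algebra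
  ultimately have eq: "integral {0..1} (\<lambda>s. (1 - m * of_real s) * (1 / (1 - u * of_real s) ^ 3)) = (v\<^sup>2 + v - m * v\<^sup>2) / 2"
    by (simp add: integral_unique)
  define a where "a = Re v"
  define b where "b = Im v"
  have nv: "(norm v)\<^sup>2 = a\<^sup>2 + b\<^sup>2" by (simp add: cmod_power2 a_def b_def)
  have "Re (m * v\<^sup>2) \<le> norm (m * v\<^sup>2)" by (rule complex_Re_le_cmod)
  also have "\<dots> \<le> r * (a\<^sup>2 + b\<^sup>2)" using m by (simp add: norm_mult norm_power nv mult_right_mono)
  finally have 1: "Re (m * v\<^sup>2) \<le> r * (a\<^sup>2 + b\<^sup>2)" .
  have "v - 1 = u * v" using \<open>u \<noteq> 1\<close> by (simp add: v_def field_simps)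
  hence "norm (v - 1) \<le> r * norm v" using u by (simp add: norm_mult mult_right_mono)
  hence "(norm (v - 1))\<^sup>2 \<le> (r * norm v)\<^sup>2" by (intro power_mono) auto
  hence "(a - 1)\<^sup>2 + b\<^sup>2 \<le> r\<^sup>2 * (a\<^sup>2 + b\<^sup>2)" unfolding power_mult_distrib nv by (simp add: cmod_power2 a_def b_def)
  hence "(1 - r) * ((1 + r) * (a\<^sup>2 + b\<^sup>2)) \<le> 2 * a - 1" by (simp add: power2_eq_square algebra_simps)
  hence 2: "(1 + r) * (a\<^sup>2 + b\<^sup>2) \<le> (2 * a - 1) / (1 - r)" using r by (simp add: pos_le_divide_eq mult.commute)
  define k where "k = (1 + r) / (1 - r)"
  have k: "(2 * a - 1) / (1 - r) = a * k + a - 1 / (1 - r)"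
    using r by (simp add: k_def divide_simps) (simp add: algebra_simps)
  have "0 \<le> 2 * (a - k / 4)\<^sup>2" by simp
  hence 3: "2 * a\<^sup>2 - a * k \<ge> - (k\<^sup>2 / 8)" by (simp add: power2_eq_square algebra_simps)
  have "2 * kernel_margin r = 1 / (1 - r) - k\<^sup>2 / 8" by (simp add: kernel_margin_def k_def)
  also have "\<dots> \<le> 2 * a\<^sup>2 + a - (1 + r) * (a\<^sup>2 + b\<^sup>2)" using 2 3 k by linarith
  also have "\<dots> = a\<^sup>2 - b\<^sup>2 + a - r * (a\<^sup>2 + b\<^sup>2)" by (simp add: algebra_simps)
  also have "\<dots> \<le> Re (v\<^sup>2 + v - m * v\<^sup>2)" using 1 by (simp add: a_def b_def power2_eq_square)
  finally show ?thesis unfolding eq by simp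
qed

lemma continuous_on_convex_comb_kernel:
  assumes "norm u \<le> r" "norm v \<le> r" "r < 1"
  shows "continuous_on ({0..1} \<times> {0..1}) (\<lambda>(t, s). 1 / (1 - (of_real t * u + of_real (1 - t) * v) * of_real s :: complex) ^ n)"
  using one_minus_mult_nz[OF norm_convex_comb_le[OF assms(1,2)] assms(3)]
  by (auto simp: case_prod_unfold simp del: of_real_diff intro!: continuous_intros)

text \<open>The identity \<open>1 / (A\<^sup>2 * B) = (\<integral>t\<in>{0..1}. 2 * t / (t * A + (1 - t) * B) ^ 3)\<close> presents the kernel as an average of
  cubed kernels whose parameters are convex combinations of \<open>u\<close> and \<open>v\<close>.\<close>
lemma kernel_bound_repeated:
  assumes u: "norm u \<le> r" and v: "norm v \<le> r" and m: "norm m \<le> r" and r: "r < 1"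
  shows "kernel_margin r \<le> Re (integral {0..1} (\<lambda>s. (1 - m * of_real s) * (1 / ((1 - u * of_real s)\<^sup>2 * (1 - v * of_real s)))))"
proof (rule average_preserves_lower_bound[where w = "\<lambda>t. 2 * t" and
     \<psi> = "\<lambda>t s. 1 / (1 - (of_real t * u + of_real (1 - t) * v) * of_real s) ^ 3"])
  show "((\<lambda>t. 2 * t) has_integral 1) {0..1 :: real}"
    using fundamental_theorem_of_calculus[of 0 1 "\<lambda>t. t\<^sup>2" "\<lambda>t. 2 * t :: real"]
    by (force intro!: derivative_eq_intros simp flip: has_real_derivative_iff_has_vector_derivative)
  fix s :: real assume s: "s \<in> {0..1}"
  define A where "A = 1 - u * of_real s"
  define B where "B = 1 - v * of_real s"
  have A: "A \<noteq> 0" and B: "B \<noteq> 0" using one_minus_mult_nz s u v r by (auto simp: A_def B_def)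
  define D where "D t = B + of_real t * (A - B)" for t :: real
  have D: "D t = 1 - (of_real t * u + of_real (1 - t) * v) * of_real s" for t by (simp add: D_def A_def B_def algebra_simps)
  have "((\<lambda>t. of_real (2 * t) * (1 / D t ^ 3)) has_integral (of_real 1)\<^sup>2 / (B * (D 1)\<^sup>2) - (of_real 0)\<^sup>2 / (B * (D 0)\<^sup>2)) {0..1}"
  proof (rule fundamental_theorem_of_calculus)
    fix t :: real assume t: "t \<in> {0..1}"
    have nz: "D t \<noteq> 0" unfolding D by (rule one_minus_mult_nz[OF norm_convex_comb_le[OF u v t] r s])
    have "((\<lambda>z. z\<^sup>2 / (B * (B + z * (A - B))\<^sup>2)) has_field_derivative of_real (2 * t) * (1 / D t ^ 3)) (at (of_real t))"
      using nz B unfolding D_def by (auto intro!: derivative_eq_intros simp: divide_simps) algebra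
    from has_vector_derivative_real_field[OF this]
    show "((\<lambda>t. (of_real t)\<^sup>2 / (B * (D t)\<^sup>2)) has_vector_derivative of_real (2 * t) * (1 / D t ^ 3)) (at t within {0..1})"
      unfolding D_def by (rule has_vector_derivative_at_within)
  qed simp
  thus "((\<lambda>t. of_real (2 * t) * (1 / (1 - (of_real t * u + of_real (1 - t) * v) * of_real s) ^ 3)) has_integral
           1 / ((1 - u * of_real s)\<^sup>2 * (1 - v * of_real s))) {0..1}"
    unfolding D[symmetric] by (simp add: A_def[symmetric] B_def[symmetric] D_def mult.commute)
next
  fix t :: real assume t: "t \<in> {0..1}"
  show "kernel_margin r \<le> Re (integral {0..1} (\<lambda>s. (1 - m * of_real s) * (1 / (1 - (of_real t * u + of_real (1 - t) * v) * of_real s) ^ 3)))"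
    by (rule kernel_bound_cube[OF norm_convex_comb_le[OF u v t] m r])
qed (use continuous_on_convex_comb_kernel[OF u v r] in \<open>auto intro!: continuous_intros\<close>)

text \<open>Here \<open>1 / (A * B) = (\<integral>t\<in>{0..1}. 1 / (t * A + (1 - t) * B)\<^sup>2)\<close> reduces three different parameters to the case
  where two of them agree.\<close>
lemma kernel_bound_distinct:
  assumes u: "norm u \<le> r" and v: "norm v \<le> r" and x: "norm x \<le> r" and m: "norm m \<le> r" and r: "r < 1"
  shows "kernel_margin r \<le> Re (integral {0..1} (\<lambda>s. (1 - m * of_real s) / (1 - x * of_real s) *
            (1 / ((1 - u * of_real s) * (1 - v * of_real s)))))"
proof (rule average_preserves_lower_bound[where w = "\<lambda>t. 1" and
     \<psi> = "\<lambda>t s. 1 / (1 - (of_real t * u + of_real (1 - t) * v) * of_real s)\<^sup>2"])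
  show "continuous_on {0..1} (\<lambda>s. (1 - m * complex_of_real s) / (1 - x * complex_of_real s))"
    using one_minus_mult_nz[OF x r] by (auto intro!: continuous_intros)
  show "((\<lambda>t. 1) has_integral 1) {0..1 :: real}" using has_integral_const_real[of 1 0 1] by simp
  fix s :: real assume s: "s \<in> {0..1}"
  define A where "A = 1 - u * of_real s"
  define B where "B = 1 - v * of_real s"
  have A: "A \<noteq> 0" and B: "B \<noteq> 0" using one_minus_mult_nz s u v r by (auto simp: A_def B_def)
  define D where "D t = B + of_real t * (A - B)" for t :: real
  have D: "D t = 1 - (of_real t * u + of_real (1 - t) * v) * of_real s" for t by (simp add: D_def A_def B_def algebra_simps)
  have "((\<lambda>t. of_real 1 * (1 / (D t)\<^sup>2)) has_integral of_real 1 / (B * D 1) - of_real 0 / (B * D 0)) {0..1}"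
  proof (rule fundamental_theorem_of_calculus)
    fix t :: real assume t: "t \<in> {0..1}"
    have nz: "D t \<noteq> 0" unfolding D by (rule one_minus_mult_nz[OF norm_convex_comb_le[OF u v t] r s])
    have "((\<lambda>z. z / (B * (B + z * (A - B)))) has_field_derivative of_real 1 * (1 / (D t)\<^sup>2)) (at (of_real t))"
      using nz B unfolding D_def by (auto intro!: derivative_eq_intros simp: divide_simps) algebra
    from has_vector_derivative_real_field[OF this]
    show "((\<lambda>t. of_real t / (B * D t)) has_vector_derivative of_real 1 * (1 / (D t)\<^sup>2)) (at t within {0..1})"
      unfolding D_def by (rule has_vector_derivative_at_within)
  qed simp
  thus "((\<lambda>t. of_real 1 * (1 / (1 - (of_real t * u + of_real (1 - t) * v) * of_real s)\<^sup>2)) has_integral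
           1 / ((1 - u * of_real s) * (1 - v * of_real s))) {0..1}"
    unfolding D[symmetric] by (simp add: A_def[symmetric] B_def[symmetric] D_def mult.commute)
next
  fix t :: real assume t: "t \<in> {0..1}"
  show "kernel_margin r \<le> Re (integral {0..1} (\<lambda>s. (1 - m * of_real s) / (1 - x * of_real s) * (1 / (1 - (of_real t * u + of_real (1 - t) * v) * of_real s)\<^sup>2)))"
    using kernel_bound_repeated[OF norm_convex_comb_le[OF u v t] x m r] by (simp add: mult.commute)
qed (use continuous_on_convex_comb_kernel[OF u v r] in \<open>auto intro!: continuous_intros\<close>)

lemma Cauchy_mean_value:
  assumes f: "f holomorphic_on cball 0 r" and r: "0 < r" and w: "norm w < r"
  shows "((\<lambda>t. f (of_real r * cis (2*pi*t)) / (1 - w * cis (-(2*pi*t)) / of_real r)) has_integral f w) {0..1}"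
proof -
  have "((\<lambda>u. f u / (u - w)) has_contour_integral (2 * of_real pi * \<i> * f w)) (circlepath 0 r)"
    using w by (intro Cauchy_integral_circlepath_simple f) auto
  hence "((\<lambda>t. f (circlepath 0 r t) / (circlepath 0 r t - w) * vector_derivative (circlepath 0 r) (at t within {0..1}))
           has_integral (2 * of_real pi * \<i> * f w)) {0..1}"
    by (simp add: has_contour_integral_def)
  hence "((\<lambda>t. (2 * of_real pi * \<i>) * (f (of_real r * cis (2*pi*t)) / (1 - w * cis (-(2*pi*t)) / of_real r)))
           has_integral (2 * of_real pi * \<i> * f w)) {0..1}"
  proof (rule has_integral_eq[rotated])
    fix t :: real assume t: "t \<in> {0..1}"
    define u where "u = of_real r * cis (2*pi*t)"
    have c: "circlepath 0 r t = u" by (simp add: circlepath u_def cis_conv_exp mult_ac)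
    have d: "vector_derivative (circlepath 0 r) (at t within {0..1}) = 2 * of_real pi * \<i> * u"
      using t by (subst vector_derivative_circlepath01) (auto simp: u_def cis_conv_exp mult_ac)
    have u: "u \<noteq> 0" using r by (simp add: u_def)
    have "norm u = r" using r by (simp add: u_def norm_mult)
    hence "u \<noteq> w" using w by auto
    have wu: "w * cis (-(2*pi*t)) / of_real r = w / u"
      by (simp add: u_def cis_mult field_simps flip: cis_inverse)
    thus "f (circlepath 0 r t) / (circlepath 0 r t - w) * vector_derivative (circlepath 0 r) (at t within {0..1}) =
      (2 * of_real pi * \<i>) * (f (of_real r * cis (2*pi*t)) / (1 - w * cis (-(2*pi*t)) / of_real r))"
      unfolding c d wu u_def[symmetric] using u \<open>u \<noteq> w\<close> by (simp add: field_simps)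
  qed
  from has_integral_mult_right[OF this, of "1 / (2 * of_real pi * \<i>)"] show ?thesis
    by (simp add: field_simps)
qed

text \<open>Cauchy's formula reproduces \<open>f\<close>. The conjugate of \<open>f\<close> on the circle is integrated against the same kernel by
  conjugating the mean value property of \<open>f z / (1 - cnj w * z / r\<^sup>2)\<close>, and contributes only \<open>cnj (f 0)\<close>.\<close>
lemma Schwarz_integral_formula:
  assumes f: "f holomorphic_on cball 0 r" and r: "0 < r" and w: "norm w < r"
  shows "((\<lambda>t. of_real (2 * Re (f (of_real r * cis (2*pi*t))) - 1) / (1 - w * cis (-(2*pi*t)) / of_real r))
           has_integral f w + cnj (f 0) - 1) {0..1}"
proof -
  define k where "k t = 1 - w * cis (-(2*pi*t)) / of_real r" for t
  define u where "u t = of_real r * cis (2*pi*t)" for t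
  have 1: "((\<lambda>t. f (u t) / k t) has_integral f w) {0..1}"
    using Cauchy_mean_value[OF assms] by (simp only: k_def u_def)
  have 3: "((\<lambda>t. 1 / k t) has_integral 1) {0..1}"
    using Cauchy_mean_value[OF _ r w, of "\<lambda>_. 1"] by (simp only: k_def holomorphic_on_const)
  have ne: "1 - cnj w * z / of_real (r\<^sup>2) \<noteq> 0" if "norm z \<le> r" for z
  proof
    assume "1 - cnj w * z / of_real (r\<^sup>2) = 0"
    hence "norm (cnj w * z / of_real (r\<^sup>2)) = 1" by simp
    moreover have "norm w * norm z < r * r" using w r that 
      by (intro order.strict_trans1[OF mult_left_mono[OF that norm_ge_zero]] mult_strict_right_mono)
    ultimately show False using r by (simp add: norm_mult norm_divide power2_eq_square)
  qed
  have "((\<lambda>t. f (u t) / (1 - cnj w * u t / of_real (r\<^sup>2))) has_integral f 0) {0..1}"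
  proof -
    have "(\<lambda>z. f z / (1 - cnj w * z / of_real (r\<^sup>2))) holomorphic_on cball 0 r"
      using r ne by (auto intro!: holomorphic_intros f)
    from Cauchy_mean_value[OF this r, of 0] show ?thesis using r by (simp add: u_def)
  qed
  from has_integral_cnj[THEN iffD2, OF this]
  have "((\<lambda>t. cnj (f (u t) / (1 - cnj w * u t / of_real (r\<^sup>2)))) has_integral cnj (f 0)) {0..1}" by (simp add: o_def)
  moreover have "cnj (f (u t) / (1 - cnj w * u t / of_real (r\<^sup>2))) = cnj (f (u t)) / k t" for t
    using r by (simp add: u_def k_def cis_cnj power2_eq_square)
  ultimately have 2: "((\<lambda>t. cnj (f (u t)) / k t) has_integral cnj (f 0)) {0..1}" by (simp only:)
  have "f (u t) / k t + cnj (f (u t)) / k t - 1 / k t = of_real (2 * Re (f (u t)) - 1) / k t" for t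
    by (simp add: complex_add_cnj flip: add_divide_distrib diff_divide_distrib)
  with has_integral_diff[OF has_integral_add[OF 1 2] 3] show ?thesis by (simp only: k_def u_def)
qed

text \<open>A function with \<open>K 0 = 1\<close> and \<open>Re K > 1 / 2\<close> is an average of the kernels \<open>1 / (1 - y * z)\<close>: the Schwarz
  formula has the density \<open>2 * Re K - 1\<close>, which is positive with integral one.\<close>
lemma bound_extends_from_kernels:
  assumes K: "K holomorphic_on ball 0 1" "K 0 = 1" "\<And>z. norm z < 1 \<Longrightarrow> Re (K z) > 1 / 2"
    and \<zeta>: "norm \<zeta> < r" and r: "r < 1" and c: "continuous_on {0..1} c"
    and lb: "\<And>u. norm u \<le> r \<Longrightarrow> \<delta> \<le> Re (integral {0..1} (\<lambda>s. c s * (1 / (1 - u * of_real s))))"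
  shows "\<delta> \<le> Re (integral {0..1} (\<lambda>s. c s * K (\<zeta> * of_real s)))"
proof -
  have r0: "0 < r" using \<zeta> norm_ge_zero[of \<zeta>] by linarith
  define q where "q = norm \<zeta> / r"
  \<comment> \<open>Any \<open>\<rho>\<close> between \<open>norm \<zeta> / r\<close> and \<open>1\<close> keeps the parameters \<open>\<zeta> / \<rho>\<close> of the kernels in the disk of radius \<open>r\<close>.\<close>
  define \<rho> where "\<rho> = (1 + q) / 2"
  have "norm \<zeta> / r < 1" using \<zeta> r0 by simp
  moreover have "0 \<le> norm \<zeta> / r" using r0 by simp
  ultimately have \<rho>: "norm \<zeta> / r < \<rho>" "\<rho> < 1" "0 < \<rho>"
    unfolding \<rho>_def q_def[symmetric] by auto
  have "norm \<zeta> * r \<le> norm \<zeta> * 1" using r by (intro mult_left_mono) auto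
  hence "norm \<zeta> \<le> norm \<zeta> / r" using r0 by (simp add: field_simps)
  hence \<zeta>\<rho>: "norm \<zeta> < \<rho>" using \<rho> by linarith
  define u where "u t = \<zeta> * cis (-(2*pi*t)) / of_real \<rho>" for t
  have u: "norm (u t) \<le> r" for t
    using \<rho> r0 by (simp add: u_def norm_mult norm_divide field_simps)
  have K\<rho>: "K holomorphic_on cball 0 \<rho>"
    using \<rho> by (intro holomorphic_on_subset[OF K(1)]) auto
  define w where "w t = 2 * Re (K (of_real \<rho> * cis (2*pi*t))) - 1" for t
  show ?thesis
  proof (rule average_preserves_lower_bound[where w = w and \<psi> = "\<lambda>t s. 1 / (1 - u t * of_real s)"])
    show "continuous_on ({0..1} \<times> {0..1}) (\<lambda>(t, s). 1 / (1 - u t * complex_of_real s))"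
      using one_minus_mult_nz[OF u r] \<rho>(3) unfolding u_def
      by (auto simp: case_prod_unfold intro!: continuous_intros)
    have "continuous_on {0..1} (\<lambda>t. K (of_real \<rho> * cis (2*pi*t)))"
      using \<rho> by (intro continuous_on_compose2[OF holomorphic_on_imp_continuous_on[OF K(1)]] continuous_intros) (auto simp: norm_mult)
    thus "continuous_on {0..1} w" unfolding w_def by (intro continuous_intros)
    show "0 \<le> w t" for t using K(3)[of "of_real \<rho> * cis (2*pi*t)"] \<rho> by (auto simp: w_def norm_mult)
    have "((\<lambda>t. complex_of_real (w t)) has_integral 1) {0..1}"
      using Schwarz_integral_formula[OF K\<rho> \<rho>(3), of 0] \<rho> K(2) by (simp add: w_def)
    from has_integral_linear[OF this bounded_linear_Re] show "(w has_integral 1) {0..1}" by (simp add: o_def)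
    fix s :: real assume s: "s \<in> {0..1}"
    have "norm (\<zeta> * of_real s) \<le> norm \<zeta>" using s by (auto simp: norm_mult intro!: mult_left_le)
    hence "norm (\<zeta> * of_real s) < \<rho>" using \<zeta>\<rho> by linarith
    from Schwarz_integral_formula[OF K\<rho> \<rho>(3) this]
    show "((\<lambda>t. of_real (w t) * (1 / (1 - u t * of_real s))) has_integral K (\<zeta> * of_real s)) {0..1}"
      using K(2) by (simp add: w_def u_def mult_ac)
  qed (use c lb u in auto)
qed

text \<open>Starting from three kernels with different parameters, each of the three factors is replaced in turn by \<open>K\<close>.\<close>
lemma cubed_half_plane_bound:
  assumes K: "K holomorphic_on ball 0 1" "K 0 = 1" "\<And>z. norm z < 1 \<Longrightarrow> Re (K z) > 1 / 2"
    and \<zeta>: "norm \<zeta> < r" and m: "norm m \<le> r" and r: "r < 1"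
  shows "kernel_margin r \<le> Re (integral {0..1} (\<lambda>s. (1 - m * of_real s) * K (\<zeta> * of_real s) ^ 3))"
proof -
  have cK: "continuous_on {0..1} (\<lambda>s. K (\<zeta> * of_real s))"
  proof (intro continuous_on_compose2[OF holomorphic_on_imp_continuous_on[OF K(1)]] continuous_intros)
    show "(\<lambda>s. \<zeta> * complex_of_real s) ` {0..1} \<subseteq> ball 0 1"
      using \<zeta> r by (auto simp: norm_mult intro!: order.strict_trans1[OF mult_left_le])
  qed
  have ck: "continuous_on {0..1} (\<lambda>s. 1 / (1 - u * complex_of_real s))" if "norm u \<le> r" for u
    using one_minus_mult_nz[OF that r] by (auto intro!: continuous_intros)
  have cm: "continuous_on {0..1} (\<lambda>s. 1 - m * complex_of_real s)" by (intro continuous_intros)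
  note ext = bound_extends_from_kernels[OF K(1,2) _ \<zeta> r]
  have 1: "kernel_margin r \<le> Re (integral {0..1} (\<lambda>s. (1 - m * of_real s) * (1 / (1 - u * of_real s)) * (1 / (1 - v * of_real s)) * K (\<zeta> * of_real s)))"
    if "norm u \<le> r" "norm v \<le> r" for u v
  proof (rule ext)
    fix x :: complex assume "norm x \<le> r"
    thus "kernel_margin r \<le> Re (integral {0..1} (\<lambda>s. (1 - m * of_real s) * (1 / (1 - u * of_real s)) * (1 / (1 - v * of_real s)) * (1 / (1 - x * of_real s))))"
      using kernel_bound_distinct[OF that, of x m] m r by (simp add: mult_ac)
  qed (intro continuous_on_mult cm ck that K(3) | assumption)+
  have 2: "kernel_margin r \<le> Re (integral {0..1} (\<lambda>s. (1 - m * of_real s) * (1 / (1 - u * of_real s)) * K (\<zeta> * of_real s) * K (\<zeta> * of_real s)))"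
    if "norm u \<le> r" for u
  proof (rule ext)
    fix x :: complex assume "norm x \<le> r"
    thus "kernel_margin r \<le> Re (integral {0..1} (\<lambda>s. (1 - m * of_real s) * (1 / (1 - u * of_real s)) * K (\<zeta> * of_real s) * (1 / (1 - x * of_real s))))"
      using 1[OF that, of x] by (simp only: mult_ac)
  qed (intro continuous_on_mult cm ck cK that K(3) | assumption)+
  have "kernel_margin r \<le> Re (integral {0..1} (\<lambda>s. (1 - m * of_real s) * K (\<zeta> * of_real s) * K (\<zeta> * of_real s) * K (\<zeta> * of_real s)))"
  proof (rule ext)
    fix x :: complex assume "norm x \<le> r"
    thus "kernel_margin r \<le> Re (integral {0..1} (\<lambda>s. (1 - m * of_real s) * K (\<zeta> * of_real s) * K (\<zeta> * of_real s) * (1 / (1 - x * of_real s))))"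
      using 2[of x] by (simp only: mult_ac)
  qed (intro continuous_on_mult cm cK K(3) | assumption)+
  thus ?thesis by (simp add: power3_eq_cube mult.assoc)
qed

section \<open>Jack's lemma and a half-plane theorem\<close>

text \<open>At a point \<open>z0\<close> of least modulus with \<open>norm (w z0) = 1\<close>, Schwarz's lemma on the disk of radius \<open>norm z0\<close>
  bounds \<open>Re (w z / w z0)\<close> by \<open>norm (z / z0)\<close>, with equality at \<open>z0\<close>. Comparing derivatives along every
  direction \<open>v\<close> that points into the disk gives \<open>Re (v * c) \<le> Re v\<close> for \<open>c = z0 * deriv w z0 / w z0\<close>, which
  means that \<open>c\<close> is real and at least one.\<close>
lemma Jack_lemma:
  assumes w: "w holomorphic_on ball 0 1" "w 0 = 0" and z1: "norm z1 < 1" "norm (w z1) \<ge> 1"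
  obtains z0 and m :: real where "norm z0 < 1" "norm (w z0) = 1" "m \<ge> 1" "z0 * deriv w z0 = of_real m * w z0"
proof -
  have cont: "continuous_on (ball 0 1) w" using w(1) by (rule holomorphic_on_imp_continuous_on)
  define S where "S = cball 0 (norm z1) \<inter> (\<lambda>z. norm (w z)) -` {1..}"
  have "closed S"
    unfolding S_def using z1
    by (intro continuous_closed_preimage continuous_on_norm continuous_on_subset[OF cont]) auto
  moreover have "bounded S" unfolding S_def by (rule bounded_subset[of "cball 0 (norm z1)"]) auto
  ultimately have "compact S" by (simp add: compact_eq_bounded_closed)
  moreover have "S \<noteq> {}" using z1 by (auto simp: S_def intro!: exI[of _ z1])
  ultimately obtain z0 where z0: "z0 \<in> S" "\<And>z. z \<in> S \<Longrightarrow> norm z0 \<le> norm z"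
    using continuous_attains_inf[of S norm] continuous_on_norm_id by blast
  define \<rho> where "\<rho> = norm z0"
  have \<rho>: "\<rho> < 1" "\<rho> > 0" and w0: "norm (w z0) \<ge> 1" using z0(1) z1 w(2) by (auto simp: S_def \<rho>_def)
  have less: "norm (w z) < 1" if "norm z < \<rho>" for z
    using z0(2)[of z] that z0(1) by (auto simp: S_def \<rho>_def not_le[symmetric])
  have schwarz: "norm (w z) \<le> norm z / \<rho>" if "norm z < \<rho>" for z
  proof -
    have "norm (w (of_real \<rho> * (z / of_real \<rho>))) \<le> norm (z / of_real \<rho>)"
    proof (rule Schwarz_Lemma(1)[of "\<lambda>z. w (of_real \<rho> * z)"])
      show "(\<lambda>z. w (complex_of_real \<rho> * z)) holomorphic_on ball 0 1"
        using \<rho> by (intro holomorphic_on_compose_gen[of "\<lambda>z. of_real \<rho> * z" _ w, unfolded o_def, OF _ w(1)] holomorphic_intros)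
          (auto simp: norm_mult intro!: mult_le_one order.strict_trans2[OF _ less_imp_le[of \<rho> 1]] mult_less_cancel_left2[THEN iffD2])
    qed (use \<rho> w less that in \<open>auto simp: norm_mult norm_divide\<close>)
    thus ?thesis using \<rho> by (simp add: norm_divide)
  qed
  have "norm (w z0) \<le> 1"
  proof (rule tendsto_upperbound)
    show "((\<lambda>r. norm (w (of_real r * z0))) \<longlongrightarrow> norm (w z0)) (at_left 1)"
    proof -
      have "isCont w z0" using cont \<rho> by (simp add: continuous_on_eq_continuous_at \<rho>_def)
      moreover have "((\<lambda>r. of_real r * z0) \<longlongrightarrow> of_real 1 * z0) (at_left (1::real))" by (intro tendsto_intros)
      ultimately show ?thesis by (intro tendsto_norm) (auto intro: isCont_tendsto_compose)
    qed
    have "eventually (\<lambda>r::real. r \<in> {0<..<1}) (at_left 1)" by (rule eventually_at_left_real) simp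
    thus "eventually (\<lambda>r. norm (w (of_real r * z0)) \<le> 1) (at_left (1::real))"
      by eventually_elim (use \<rho> less in \<open>auto simp: norm_mult \<rho>_def intro!: less_imp_le\<close>)
  qed simp
  hence w1: "norm (w z0) = 1" using w0 by simp
  hence wz: "w z0 \<noteq> 0" by auto
  define c where "c = z0 * deriv w z0 / w z0"
  have key: "Re (v * c) \<le> Re v" if v: "Re v < 0" for v
  proof (rule ccontr)
    assume neg: "\<not> ?thesis"
    \<comment> \<open>The polynomial part is \<open>(1 + (norm (1 + \<tau> * v))\<^sup>2) / 2\<close>, a smooth upper bound for \<open>norm (1 + \<tau> * v)\<close>.\<close>
    define D where "D \<tau> = 1 + \<tau> * Re v + \<tau>\<^sup>2 * (norm v)\<^sup>2 / 2 - Re (w (z0 * (1 + of_real \<tau> * v)) / w z0)" for \<tau> :: real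
    have "((\<lambda>\<tau>. w (z0 * (1 + of_real \<tau> * v)) / w z0) has_vector_derivative (v * c)) (at 0)"
    proof -
      have "(w has_field_derivative deriv w z0) (at (z0 * (1 + of_real 0 * v)))"
        using \<rho> holomorphic_derivI[OF w(1) open_ball, of z0] by (auto simp: \<rho>_def)
      moreover have "((\<lambda>\<tau>. z0 * (1 + of_real \<tau> * v)) has_vector_derivative (z0 * v)) (at 0)"
        by (auto intro!: derivative_eq_intros)
      ultimately have "((\<lambda>\<tau>. w (z0 * (1 + of_real \<tau> * v))) has_vector_derivative (z0 * v * deriv w z0)) (at 0)"
        using field_vector_diff_chain_at by (fastforce simp: o_def)
      from has_vector_derivative_mult_right[OF this, of "1 / w z0"] show ?thesis
        by (simp add: c_def field_simps)
    qed
    hence "((\<lambda>\<tau>. Re (w (z0 * (1 + of_real \<tau> * v)) / w z0)) has_real_derivative Re (v * c)) (at 0)"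
      by (simp add: has_vector_derivative_complex_iff)
    moreover have "((\<lambda>\<tau>. 1 + \<tau> * Re v + \<tau>\<^sup>2 * (norm v)\<^sup>2 / 2) has_real_derivative Re v) (at 0)"
      by (auto intro!: derivative_eq_intros)
    ultimately have "(D has_real_derivative (Re v - Re (v * c))) (at 0)"
      unfolding D_def[abs_def] by (intro DERIV_diff)
    from DERIV_neg_dec_right[OF this] obtain d where d: "d > 0" "\<And>h. 0 < h \<Longrightarrow> h < d \<Longrightarrow> D h < D 0"
      using neg by fastforce
    have "v \<noteq> 0" using v by auto
    \<comment> \<open>The second bound keeps \<open>1 + h * v\<close> inside the unit disk.\<close>
    define h where "h = min (d / 2) (- Re v / (norm v)\<^sup>2)"
    have "h > 0" using d v \<open>v \<noteq> 0\<close> by (auto simp: h_def divide_neg_pos)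
    moreover have "h \<le> d / 2" unfolding h_def by (rule min.cobounded1)
    ultimately have h: "h > 0" "h < d" using d(1) by linarith+
    have "h * (norm v)\<^sup>2 \<le> - Re v"
      using \<open>v \<noteq> 0\<close> by (simp add: h_def min_def field_simps)
    have sq: "(norm (1 + of_real h * v))\<^sup>2 = 1 + 2 * (h * Re v) + h\<^sup>2 * (norm v)\<^sup>2"
      unfolding cmod_power2 by (simp add: power2_eq_square algebra_simps)
    also have "\<dots> = 1 + h * (2 * Re v + h * (norm v)\<^sup>2)" by (simp add: power2_eq_square algebra_simps)
    also have "\<dots> < 1" using h v \<open>h * (norm v)\<^sup>2 \<le> - Re v\<close> by (simp add: mult_pos_neg)
    finally have lt: "norm (1 + of_real h * v) < 1" by (simp add: power_less_one_iff abs_square_less_1)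
    have "Re (w (z0 * (1 + of_real h * v)) / w z0) \<le> norm (w (z0 * (1 + of_real h * v)) / w z0)" by (rule complex_Re_le_cmod)
    also have "\<dots> \<le> norm (1 + of_real h * v)"
      using schwarz[of "z0 * (1 + of_real h * v)"] \<rho> lt by (simp add: norm_divide w1 norm_mult \<rho>_def)
    also have "\<dots> \<le> (1 + (norm (1 + of_real h * v))\<^sup>2) / 2"
      using zero_le_power2[of "norm (1 + of_real h * v) - 1"] by (simp add: power2_eq_square algebra_simps)
    also have "\<dots> = 1 + h * Re v + h\<^sup>2 * (norm v)\<^sup>2 / 2" unfolding sq by (simp add: field_simps)
    finally have "D h \<ge> 0" by (simp add: D_def)
    moreover have "D 0 = 0" using wz by (simp add: D_def)
    ultimately show False using d(2)[OF h] by simp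
  qed
  have "Re c \<ge> 1" using key[of "-1"] by simp
  moreover have "Im c = 0"
  proof (rule ccontr)
    assume "Im c \<noteq> 0"
    \<comment> \<open>Directions \<open>- e \<plusminus> \<i>\<close> approach the tangent of the circle as \<open>e\<close> tends to zero; this \<open>e\<close> is small enough.\<close>
    define e where "e = (\<bar>Im c\<bar> / (2 * Re c))"
    have "e > 0" using \<open>Im c \<noteq> 0\<close> \<open>Re c \<ge> 1\<close> by (simp add: e_def)
    have "e * Re c = \<bar>Im c\<bar> / 2" using \<open>Re c \<ge> 1\<close> by (simp add: e_def)
    thus False using key[of "Complex (-e) (- sgn (Im c))"] \<open>e > 0\<close> \<open>Im c \<noteq> 0\<close>
      by (auto simp: sgn_if split: if_splits)
  qed
  ultimately have "c = of_real (Re c)" by (simp add: complex_eq_iff)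
  hence "z0 * deriv w z0 = of_real (Re c) * w z0" using wz by (simp add: c_def field_simps)
  thus ?thesis using that[of z0 "Re c"] \<rho> w1 \<open>Re c \<ge> 1\<close> by (simp add: \<rho>_def)
qed

text \<open>This is the theorem of Marx and Strohhaecker, that \<open>Re (sqrt (deriv F)) > 1 / 2\<close> for a normalised convex
  function \<open>F\<close>, stated for \<open>K = sqrt (deriv F)\<close>. The condition on \<open>K\<close> is
  \<open>Re (1 + 2 * z * deriv K z / K z) > 0\<close> written with a Schwarz function. The conclusion is
  \<open>norm (1 - 1 / K z) < 1\<close>; where this first fails, Jack's lemma contradicts the condition.\<close>
lemma Re_gt_half_of_logarithmic_derivative:
  assumes K: "K holomorphic_on ball 0 1" "K 0 = 1" "\<And>z. norm z < 1 \<Longrightarrow> K z \<noteq> 0"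
    and e: "\<And>z. norm z < 1 \<Longrightarrow> \<exists>e. norm e \<le> 1 \<and> deriv K z = K z * e / (1 - e * z)"
    and z: "norm z < 1"
  shows "Re (K z) > 1 / 2"
proof (rule ccontr)
  assume neg: "\<not> Re (K z) > 1 / 2"
  define w where "w z = 1 - 1 / K z" for z
  have "(norm (K z - 1))\<^sup>2 = (norm (K z))\<^sup>2 + (1 - 2 * Re (K z))"
    unfolding cmod_power2 by (simp add: power2_eq_square algebra_simps)
  hence "(norm (K z))\<^sup>2 \<le> (norm (K z - 1))\<^sup>2" using neg by linarith
  hence "norm (K z) \<le> norm (K z - 1)" by (rule power2_le_imp_le) simp
  moreover have "w z = (K z - 1) / K z" using K(3)[OF z] by (simp add: w_def field_simps)
  ultimately have "norm (w z) \<ge> 1" using K(3)[OF z] by (simp add: norm_divide)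
  moreover have "w holomorphic_on ball 0 1"
    unfolding w_def using K by (intro holomorphic_intros) auto
  moreover have "w 0 = 0" by (simp add: w_def K)
  ultimately obtain z0 and m :: real where z0: "norm z0 < 1" "norm (w z0) = 1" "m \<ge> 1" "z0 * deriv w z0 = of_real m * w z0"
    using z Jack_lemma by metis
  obtain e where e: "norm e \<le> 1" "deriv K z0 = K z0 * e / (1 - e * z0)" using assms(4)[OF z0(1)] by blast
  have "norm (e * z0) < 1" using mult_le_one[OF e(1), of "norm z0"] e(1) z0(1) 
    by (simp add: norm_mult) (metis mult_left_le_one_le norm_ge_zero order_le_less_trans)
  hence nz: "1 - e * z0 \<noteq> 0" by auto
  have "(w has_field_derivative deriv K z0 / (K z0)\<^sup>2) (at z0)"
    unfolding w_def using K(3)[OF z0(1)] holomorphic_derivI[OF K(1) open_ball, of z0] z0(1)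
    by (auto intro!: derivative_eq_intros simp: power2_eq_square)
  hence "deriv w z0 = deriv K z0 / (K z0)\<^sup>2" by (rule DERIV_imp_deriv)
  also have "\<dots> = (1 - w z0) * e / (1 - e * z0)"
    using K(3)[OF z0(1)] by (simp add: e w_def power2_eq_square)
  finally have "of_real m * w z0 * (1 - e * z0) = (1 - w z0) * (e * z0)"
    using z0(4) nz by (simp add: field_simps)
  hence eq: "of_real m * w z0 = (e * z0) * (1 + of_real (m - 1) * w z0)" by (simp add: algebra_simps)
  have "norm (1 + of_real (m - 1) * w z0) \<le> 1 + (m - 1)"
    using norm_triangle_ineq[of 1 "of_real (m - 1) * w z0"] z0 by (simp add: norm_mult del: of_real_diff)
  hence le: "norm (1 + of_real (m - 1) * w z0) \<le> m" by simp
  have "m = norm (of_real m * w z0)" using z0 by (simp add: norm_mult)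
  also have "\<dots> = norm (e * z0) * norm (1 + of_real (m - 1) * w z0)" by (simp only: eq norm_mult)
  also have "\<dots> \<le> norm (e * z0) * m" using le by (intro mult_left_mono) auto
  also have "\<dots> < m" using \<open>norm (e * z0) < 1\<close> z0(3) by simp
  finally show False by simp
qed

section \<open>The Koebe transform and the radius of starlikeness\<close>

lemma one_plus_mult_nz:
  fixes a z :: complex
  assumes "norm a \<le> 1" "norm z < 1"
  shows "1 + a * z \<noteq> 0"
proof
  assume "1 + a * z = 0"
  hence "norm (a * z) = 1" by (metis add_eq_0_iff norm_minus_cancel norm_one)
  moreover have "norm a * norm z \<le> 1 * norm z" using assms by (intro mult_right_mono) auto
  ultimately show False using assms(2) by (simp add: norm_mult)
qed

lemma norm_diff_cnj_le:
  fixes e a :: complex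
  assumes "norm e \<le> 1" "norm a < 1"
  shows "norm (e - cnj a) \<le> norm (1 - e * a)"
proof -
  have "(norm (1 - e * a))\<^sup>2 - (norm (e - cnj a))\<^sup>2 = (1 - (norm e)\<^sup>2) * (1 - (norm a)\<^sup>2)"
    unfolding cmod_power2 by (simp add: power2_eq_square algebra_simps)
  moreover have "(1 - (norm e)\<^sup>2) * (1 - (norm a)\<^sup>2) \<ge> 0"
    using assms by (intro mult_nonneg_nonneg) (auto simp: power_le_one)
  ultimately have "(norm (e - cnj a))\<^sup>2 \<le> (norm (1 - e * a))\<^sup>2" by linarith
  thus ?thesis by (rule power2_le_imp_le) simp
qed

text \<open>The values \<open>1 + 2 / 3 * z * deriv p z / p z\<close> have positive real part, so they are \<open>(1 + w z) / (1 - w z)\<close> with a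
  Schwarz function \<open>w\<close>, and \<open>w z = z * e\<close> with \<open>norm e \<le> 1\<close>. The pointwise form, in which \<open>e\<close> may vary with
  \<open>z\<close>, is stable under disk automorphisms.\<close>
lemma logarithmic_derivative_form:
  assumes p: "p holomorphic_on ball 0 1" "\<And>z. norm z < 1 \<Longrightarrow> p z \<noteq> 0"
    and re: "\<And>z. norm z < 1 \<Longrightarrow> Re (1 + z * deriv p z / p z) > - 1 / 2"
    and z: "norm z < 1"
  shows "\<exists>e. norm e \<le> 1 \<and> deriv p z = 3 * p z * e / (1 - e * z)"
proof -
  define q where "q z = deriv p z / p z" for z
  define e where "e z = q z / (3 + z * q z)" for z
  have req: "Re (z * q z) > - 3 / 2" if "norm z < 1" for z using re[OF that] by (simp add: q_def)
  have nz: "3 + z * q z \<noteq> 0" if "norm z < 1" for z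
  proof
    assume "3 + z * q z = 0"
    hence "Re (3 + z * q z) = 0" by simp
    thus False using req[OF that] by simp
  qed
  have q: "q holomorphic_on ball 0 1" unfolding q_def using p by (intro holomorphic_intros) auto
  have e: "e holomorphic_on ball 0 1" unfolding e_def using nz by (intro holomorphic_intros q) auto
  have ze: "(\<lambda>z. z * e z) holomorphic_on ball 0 1" by (intro holomorphic_intros e)
  have lt: "norm (z * e z) < 1" if "norm z < 1" for z
  proof -
    have "(norm (z * q z))\<^sup>2 < (norm (3 + z * q z))\<^sup>2"
      using req[OF that] unfolding cmod_power2 by (simp add: power2_eq_square algebra_simps)
    hence "norm (z * q z) < norm (3 + z * q z)" by (rule power2_less_imp_less) simp
    thus ?thesis using nz[OF that] by (simp add: e_def norm_divide)
  qed
  have "deriv (\<lambda>z. z * e z) 0 = e 0"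
    using holomorphic_derivI[OF e open_ball, of 0]
    by (intro DERIV_imp_deriv) (auto intro!: derivative_eq_intros)
  hence e0: "norm (e 0) \<le> 1" using Schwarz_Lemma(2)[OF ze _ lt z] by simp
  have "norm (e z) \<le> 1"
  proof (cases "z = 0")
    case False
    have "norm (z * e z) \<le> norm z" using Schwarz_Lemma(1)[OF ze _ lt z] by simp
    thus ?thesis using False by (simp add: norm_mult)
  qed (use e0 in simp)
  moreover have "deriv p z = 3 * p z * e z / (1 - e z * z)"
  proof -
    have "1 - e z * z = 3 / (3 + z * q z)" using nz[OF z] by (simp add: e_def field_simps)
    hence "3 * e z / (1 - e z * z) = q z" using nz[OF z] by (simp add: e_def)
    hence "p z * (3 * e z / (1 - e z * z)) = p z * q z" by simp
    thus ?thesis using p(2)[OF z] by (simp add: q_def mult_ac)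
  qed
  ultimately show ?thesis by blast
qed

text \<open>The condition on the logarithmic derivative is invariant: if \<open>e\<close> serves for \<open>k\<close> at the image point, then
  \<open>(e - cnj a) / (1 - e * a)\<close>, again of modulus at most one, serves for \<open>K\<close>. Indeed the factor \<open>1 - e * z\<close> is
  carried to a multiple of a factor of the same kind, divided by \<open>1 + cnj a * z\<close>.\<close>
lemma Koebe_transform_half_plane:
  assumes k: "k holomorphic_on ball 0 1" "\<And>z. norm z < 1 \<Longrightarrow> k z \<noteq> 0"
    and e: "\<And>z. norm z < 1 \<Longrightarrow> \<exists>e. norm e \<le> 1 \<and> deriv k z = k z * e / (1 - e * z)"
    and a: "norm a < 1"
  defines "K \<equiv> (\<lambda>z. k ((z + a) / (1 + cnj a * z)) / (k a * (1 + cnj a * z)))"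
  shows "K holomorphic_on ball 0 1" "K 0 = 1" "\<And>z. norm z < 1 \<Longrightarrow> Re (K z) > 1 / 2"
proof -
  define T where "T z = (z + a) / (1 + cnj a * z)" for z
  have T: "norm (T z) < 1" if "norm z < 1" for z
    using Moebius_function_norm_lt_1[of "-a" z 0] a that by (simp add: T_def Moebius_function_simple)
  have Th: "T holomorphic_on ball 0 1"
    using Moebius_function_holomorphic[of "-a" 0] a by (simp add: T_def[abs_def] Moebius_function_simple[abs_def])
  have nz: "1 + cnj a * z \<noteq> 0" if "norm z < 1" for z
    using one_plus_mult_nz[of "cnj a" z] a that by simp
  have K: "K z = k (T z) / (k a * (1 + cnj a * z))" for z by (simp add: K_def T_def)
  have kT: "(\<lambda>z. k (T z)) holomorphic_on ball 0 1"
    using T by (intro holomorphic_on_compose_gen[OF Th k(1), unfolded o_def]) auto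
  have ka: "k a \<noteq> 0" using k(2)[OF a] .
  show hol: "K holomorphic_on ball 0 1"
    unfolding K[abs_def] using ka nz by (intro holomorphic_intros kT) auto
  show K0: "K 0 = 1" using ka by (simp add: K_def)
  show "Re (K z) > 1 / 2" if z: "norm z < 1" for z
  proof (rule Re_gt_half_of_logarithmic_derivative[OF hol K0 _ _ z])
    show "K z \<noteq> 0" if "norm z < 1" for z using k(2)[OF T[OF that]] ka nz[OF that] by (simp add: K)
    fix z :: complex assume z: "norm z < 1"
    obtain e where e: "norm e \<le> 1" "deriv k (T z) = k (T z) * e / (1 - e * T z)" using e[OF T[OF z]] by blast
    define d where "d = (e - cnj a) / (1 - e * a)"
    have ea: "1 - e * a \<noteq> 0" using one_plus_mult_nz[of "-e" a] e(1) a by simp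
    have eT: "1 - e * T z \<noteq> 0" using one_plus_mult_nz[of "-e" "T z"] e(1) T[OF z] by simp
    have "norm d \<le> 1"
      using norm_diff_cnj_le[OF e(1) a] ea by (simp add: d_def norm_divide)
    moreover have "deriv K z = K z * d / (1 - d * z)"
    proof -
      have dT: "(T has_field_derivative (1 - cnj a * a) / (1 + cnj a * z)\<^sup>2) (at z)"
        unfolding T_def using nz[OF z] 
        by (auto intro!: derivative_eq_intros simp: divide_simps power2_eq_square) (simp add: algebra_simps)
      have dk: "(k has_field_derivative deriv k (T z)) (at (T z))"
        using T[OF z] by (intro holomorphic_derivI[OF k(1)]) auto
      have "((\<lambda>z. k (T z)) has_field_derivative deriv k (T z) * ((1 - cnj a * a) / (1 + cnj a * z)\<^sup>2)) (at z)"
        using DERIV_chain2[OF dk dT] by simp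
      moreover have "((\<lambda>z. k a * (1 + cnj a * z)) has_field_derivative k a * cnj a) (at z)"
        by (auto intro!: derivative_eq_intros)
      ultimately have "(K has_field_derivative
          (deriv k (T z) * ((1 - cnj a * a) / (1 + cnj a * z)\<^sup>2) * (k a * (1 + cnj a * z)) - k (T z) * (k a * cnj a)) /
          ((k a * (1 + cnj a * z)) * (k a * (1 + cnj a * z)))) (at z)"
        unfolding K[abs_def] using ka nz[OF z] by (intro DERIV_divide) auto
      hence "deriv K z = (deriv k (T z) * ((1 - cnj a * a) / (1 + cnj a * z)\<^sup>2) * (k a * (1 + cnj a * z)) - k (T z) * (k a * cnj a)) /
          ((k a * (1 + cnj a * z)) * (k a * (1 + cnj a * z)))" by (rule DERIV_imp_deriv)
      also have "\<dots> = K z * (e * (1 - cnj a * a) / ((1 + cnj a * z)\<^sup>2 * (1 - e * T z)) - cnj a / (1 + cnj a * z))"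
        unfolding e(2) K using ka nz[OF z] eT by (simp add: divide_simps power2_eq_square) (simp add: algebra_simps)
      also have "e * (1 - cnj a * a) / ((1 + cnj a * z)\<^sup>2 * (1 - e * T z)) - cnj a / (1 + cnj a * z) = d / (1 - d * z)"
      proof -
        define N where "N = 1 + cnj a * z - e * a - e * z"
        have 1: "1 - e * T z = N / (1 + cnj a * z)" using nz[OF z] by (simp add: T_def N_def field_simps)
        hence "N \<noteq> 0" using eT by auto
        have "1 - d * z = N / (1 - e * a)" using ea by (simp add: d_def N_def field_simps)
        hence "d / (1 - d * z) = (e - cnj a) / N" using ea by (simp add: d_def)
        also have "\<dots> = e * (1 - cnj a * a) / ((1 + cnj a * z) * N) - cnj a / (1 + cnj a * z)"
          using \<open>N \<noteq> 0\<close> nz[OF z] by (simp add: divide_simps) (simp add: N_def algebra_simps)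
        finally show ?thesis unfolding 1 using nz[OF z] by (simp add: power2_eq_square)
      qed
      finally show ?thesis by simp
    qed
    ultimately show "\<exists>e. norm e \<le> 1 \<and> deriv K z = K z * e / (1 - e * z)" by blast
  qed
qed

text \<open>Let \<open>T\<close> be the disk automorphism with \<open>T 0 = a\<close> and \<open>T (- a) = 0\<close>. Integrating \<open>deriv F\<close> along the image
  under \<open>T\<close> of the segment from \<open>0\<close> to \<open>- a\<close> expresses \<open>F a / (a * deriv F a)\<close> as
  \<open>1 - (norm a)\<^sup>2\<close> times the integral of \<open>(1 - m * s) * K (- a * s) ^ 3\<close>, with \<open>K\<close> the Koebe transform of the cube
  root of \<open>p\<close> and \<open>m = a * (b + cnj a) / (1 + b * a)\<close>. This turns a quotient into a linear functional of
  \<open>K ^ 3\<close>, and \<open>Re K > 1 / 2\<close> bounds it below.\<close>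
lemma starlikeness_quotient:
  assumes p: "p holomorphic_on ball 0 1" "\<And>z. norm z < 1 \<Longrightarrow> p z \<noteq> 0"
    and e: "\<And>z. norm z < 1 \<Longrightarrow> \<exists>e. norm e \<le> 1 \<and> deriv p z = 3 * p z * e / (1 - e * z)"
    and F: "F holomorphic_on ball 0 1" "F 0 = 0" "\<And>z. norm z < 1 \<Longrightarrow> deriv F z = (1 + b * z) * p z"
    and b: "norm b \<le> 1" and a: "a \<noteq> 0" "norm a < 4 * sqrt 2 - 5"
  shows "Re (F a / (a * deriv F a)) > 0"
proof -
  obtain r where r: "norm a < r" "r < 4 * sqrt 2 - 5" using dense[OF a(2)] by blast
  have "sqrt 2 < 3 / 2" by (rule real_less_lsqrt) (auto simp: power2_eq_square)
  hence r1: "r < 1" using r by simp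
  hence a1: "norm a < 1" using r by simp
  have r0: "0 \<le> r" using r(1) norm_ge_zero[of a] by linarith
  have "convex (ball (0::complex) 1)" "(0::complex) \<in> ball 0 1" by auto
  then obtain l where l: "l holomorphic_on ball 0 1" "\<And>z. z \<in> ball 0 1 \<Longrightarrow> exp (l z) = p z"
    using holomorphic_logarithm_exists[OF _ open_ball p(1)] p(2) by (metis mem_ball_0)
  define k where "k z = exp (l z / 3)" for z
  have k3: "k z ^ 3 = p z" if "norm z < 1" for z
    using l(2)[of z] that by (simp add: k_def flip: exp_of_nat_mult)
  have k: "k holomorphic_on ball 0 1" unfolding k_def by (intro holomorphic_intros l) auto
  have knz: "k z \<noteq> 0" for z by (simp add: k_def)
  have ke: "\<exists>e. norm e \<le> 1 \<and> deriv k z = k z * e / (1 - e * z)" if z: "norm z < 1" for z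
  proof -
    obtain e where e: "norm e \<le> 1" "deriv p z = 3 * p z * e / (1 - e * z)" using e[OF z] by blast
    have dk: "(k has_field_derivative deriv k z) (at z)"
      using z by (intro holomorphic_derivI[OF k]) auto
    have "((\<lambda>z. k z ^ 3) has_field_derivative 3 * k z ^ 2 * deriv k z) (at z)"
      by (rule derivative_eq_intros dk refl)+ simp
    hence "(p has_field_derivative 3 * k z ^ 2 * deriv k z) (at z)"
      by (rule has_field_derivative_transform_within_open[where S = "ball 0 1"]) (use z k3 in auto)
    hence "deriv p z = 3 * k z ^ 2 * deriv k z" by (rule DERIV_imp_deriv)
    hence "3 * k z ^ 2 * deriv k z = 3 * k z ^ 3 * e / (1 - e * z)"
      using e(2) by (simp only: k3[OF z])
    hence "3 * k z ^ 2 * deriv k z = 3 * k z ^ 2 * (k z * e / (1 - e * z))"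
      by (simp add: power2_eq_square power3_eq_cube)
    hence "deriv k z = k z * e / (1 - e * z)" using knz[of z] by (simp del: times_divide_eq_right)
    thus ?thesis using e(1) by blast
  qed
  define K where "K = (\<lambda>z. k ((z + a) / (1 + cnj a * z)) / (k a * (1 + cnj a * z)))"
  have K: "K holomorphic_on ball 0 1" "K 0 = 1" "\<And>z. norm z < 1 \<Longrightarrow> Re (K z) > 1 / 2"
    unfolding K_def using Koebe_transform_half_plane[OF k knz ke a1] by blast+
  have ba: "1 + b * a \<noteq> 0" by (rule one_plus_mult_nz[OF b a1])
  define m where "m = a * (b + cnj a) / (1 + b * a)"
  have "norm (b + cnj a) \<le> norm (1 + b * a)"
    using norm_diff_cnj_le[of "-b" a] b a1 by (simp add: norm_minus_commute[of "-b"] add.commute)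
  hence "norm m \<le> norm a * 1" unfolding m_def norm_mult norm_divide times_divide_eq_right[symmetric]
    using ba by (intro mult_left_mono) auto
  hence m: "norm m \<le> r" using r by simp
  define I where "I = integral {0..1} (\<lambda>s. (1 - m * of_real s) * K (- a * of_real s) ^ 3)"
  have "kernel_margin r \<le> Re I" unfolding I_def using r m r1 by (intro cubed_half_plane_bound K) auto
  hence I: "Re I > 0" using kernel_margin_pos[OF r0 r(2)] by simp
  define T where "T s = (a - a * s) / (1 - cnj a * (a * s))" for s :: complex
  have "((\<lambda>s. - a * (1 - cnj a * a) * deriv F a * ((1 - m * of_real s) * K (- a * of_real s) ^ 3)) has_integral
      F (T (of_real 1)) - F (T (of_real 0))) {0..1}"
  proof (rule fundamental_theorem_of_calculus)
    fix s :: real assume s: "s \<in> {0..1}"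
    define z where "z = - a * of_real s"
    have "norm z \<le> norm a" using s by (auto simp: z_def norm_mult intro!: mult_left_le)
    hence z: "norm z < 1" using a1 by simp
    have T: "T (of_real s) = (z + a) / (1 + cnj a * z)" by (simp add: T_def z_def)
    have T1: "norm (T (of_real s)) < 1"
      using Moebius_function_norm_lt_1[of "-a" z 0] a1 z by (simp add: T Moebius_function_simple)
    have nz: "1 + cnj a * z \<noteq> 0" using one_plus_mult_nz[of "cnj a" z] a1 z by simp
    have dT: "(T has_field_derivative - a * (1 - cnj a * a) / (1 + cnj a * z)\<^sup>2) (at (of_real s))"
      unfolding T_def using nz unfolding z_def
      by (auto intro!: derivative_eq_intros simp: divide_simps power2_eq_square) (simp add: algebra_simps)
    have dF: "(F has_field_derivative deriv F (T (of_real s))) (at (T (of_real s)))"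
      using T1 by (intro holomorphic_derivI[OF F(1)]) auto
    have "((\<lambda>s. F (T s)) has_field_derivative deriv F (T (of_real s)) * (- a * (1 - cnj a * a) / (1 + cnj a * z)\<^sup>2)) (at (of_real s))"
      by (rule DERIV_chain2[OF dF dT])
    from has_vector_derivative_real_field[OF this]
    have "((\<lambda>s. F (T (of_real s))) has_vector_derivative deriv F (T (of_real s)) * (- a * (1 - cnj a * a) / (1 + cnj a * z)\<^sup>2)) (at s within {0..1})"
      by (rule has_vector_derivative_at_within)
    also have "deriv F (T (of_real s)) * (- a * (1 - cnj a * a) / (1 + cnj a * z)\<^sup>2) =
        - a * (1 - cnj a * a) * deriv F a * ((1 - m * of_real s) * K (- a * of_real s) ^ 3)"
    proof -
      have bT: "(1 + b * T (of_real s)) * (1 + cnj a * z) = (1 + b * a) * (1 - m * of_real s)"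
        using nz ba unfolding T by (simp add: m_def z_def field_simps)
      have Kz: "K z = k (T (of_real s)) / (k a * (1 + cnj a * z))" by (simp add: K_def T)
      have "deriv F (T (of_real s)) / (1 + cnj a * z)\<^sup>2 = (1 + b * T (of_real s)) * k (T (of_real s)) ^ 3 / (1 + cnj a * z)\<^sup>2"
        using F(3)[OF T1] k3[OF T1] by simp
      also have "\<dots> = ((1 + b * T (of_real s)) * (1 + cnj a * z)) * k (T (of_real s)) ^ 3 / (1 + cnj a * z) ^ 3"
        using nz by (simp add: power2_eq_square power3_eq_cube)
      also have "\<dots> = (1 + b * a) * k a ^ 3 * ((1 - m * of_real s) * K z ^ 3)"
        unfolding bT Kz using nz knz[of a] by (simp add: power_divide power_mult_distrib)
      also have "(1 + b * a) * k a ^ 3 = deriv F a" using F(3)[OF a1] k3[OF a1] by simp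
      finally have *: "deriv F (T (of_real s)) / (1 + cnj a * z)\<^sup>2 =
        deriv F a * ((1 - m * of_real s) * K z ^ 3)" .
      have "deriv F (T (of_real s)) * (- a * (1 - cnj a * a) / (1 + cnj a * z)\<^sup>2) =
          - a * (1 - cnj a * a) * (deriv F (T (of_real s)) / (1 + cnj a * z)\<^sup>2)" by simp
      also have "\<dots> = - a * (1 - cnj a * a) * deriv F a * ((1 - m * of_real s) * K z ^ 3)"
        unfolding * by (simp only: mult.assoc)
      finally show ?thesis by (simp only: z_def)
    qed
    finally show "((\<lambda>s. F (T (of_real s))) has_vector_derivative 
        - a * (1 - cnj a * a) * deriv F a * ((1 - m * of_real s) * K (- a * of_real s) ^ 3)) (at s within {0..1})" .
  qed simp
  moreover have "F (T (of_real 1)) - F (T (of_real 0)) = - F a" using F(2) by (simp add: T_def)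
  ultimately have "integral {0..1} (\<lambda>s. - a * (1 - cnj a * a) * deriv F a * ((1 - m * of_real s) * K (- a * of_real s) ^ 3)) = - F a"
    by (simp only: integral_unique)
  hence "F a = a * deriv F a * (of_real (1 - (norm a)\<^sup>2) * I)"
    by (simp add: I_def complex_norm_square mult_ac del: of_real_power)
  moreover have "deriv F a \<noteq> 0" using F(3)[OF a1] ba p(2)[OF a1] by simp
  ultimately have "F a / (a * deriv F a) = of_real (1 - (norm a)\<^sup>2) * I" using a by simp
  moreover have "1 - (norm a)\<^sup>2 > 0" using a1 by (simp add: power_less_one_iff abs_square_less_1)
  ultimately show ?thesis using I by simp
qed

section \<open>The radius of convexity\<close>

lemma Re_over_one_minus_bounds:
  fixes w :: complex
  assumes w: "norm w \<le> r" and r: "r < 1"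
  shows "- (r / (1 + r)) \<le> Re (w / (1 - w))" "Re (w / (1 - w)) \<le> r / (1 - r)"
proof -
  have r0: "0 \<le> r" using w norm_ge_zero[of w] by linarith
  define x where "x = Re w"
  have nz: "w \<noteq> 1" using w r by auto
  hence eq: "w / (1 - w) = 1 / (1 - w) - 1" by (simp add: field_simps)
  have "norm (1 - w) \<ge> 1 - r" using norm_triangle_ineq2[of 1 w] w by simp
  hence n: "norm (1 / (1 - w)) \<le> 1 / (1 - r)" using r by (simp add: norm_divide frac_le)
  have "Re (w / (1 - w)) \<le> 1 / (1 - r) - 1"
    using complex_Re_le_cmod[of "1 / (1 - w)"] n unfolding eq by simp
  also have "\<dots> = r / (1 - r)" using r by (simp add: field_simps)
  finally show "Re (w / (1 - w)) \<le> r / (1 - r)" .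
  have "- r \<le> x" using w abs_Re_le_cmod[of w] unfolding x_def by linarith
  hence "0 \<le> (1 - r) * (x + r)" using r by (intro mult_nonneg_nonneg) auto
  moreover have "(norm w)\<^sup>2 \<le> r\<^sup>2" using w by (intro power_mono) auto
  moreover have "(norm (1 - w))\<^sup>2 = 1 - 2 * x + (norm w)\<^sup>2"
    unfolding cmod_power2 x_def by (simp add: power2_eq_square algebra_simps)
  ultimately have "(norm (1 - w))\<^sup>2 \<le> (1 - x) * (1 + r)" by (simp add: power2_eq_square algebra_simps)
  moreover have "(norm (1 - w))\<^sup>2 > 0" using nz by simp
  ultimately have "1 / (1 + r) \<le> (1 - x) / (norm (1 - w))\<^sup>2"
    using r0 by (simp add: field_simps)
  also have "\<dots> = Re (1 / (1 - w))" by (simp add: Re_divide' x_def)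
  finally have "1 / (1 + r) - 1 \<le> Re (w / (1 - w))" unfolding eq by simp
  moreover have "1 / (1 + r) - 1 = - (r / (1 + r))" using r0 by (simp add: field_simps)
  ultimately show "- (r / (1 + r)) \<le> Re (w / (1 - w))" by simp
qed

text \<open>The quotient is \<open>1 + 3 * (e * a) / (1 - e * a) + b * a / (1 + b * a)\<close>, with real part at least
  \<open>1 - 3 * r / (1 + r) - r / (1 - r) = (1 - 4 * r + r\<^sup>2) / (1 - r\<^sup>2)\<close> for \<open>r = norm a\<close>; the smaller root of the
  numerator is \<open>2 - sqrt 3\<close>.\<close>
lemma convexity_quotient:
  assumes p: "p holomorphic_on ball 0 1" "\<And>z. norm z < 1 \<Longrightarrow> p z \<noteq> 0"
    and e: "\<And>z. norm z < 1 \<Longrightarrow> \<exists>e. norm e \<le> 1 \<and> deriv p z = 3 * p z * e / (1 - e * z)"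
    and F: "\<And>z. norm z < 1 \<Longrightarrow> deriv F z = (1 + b * z) * p z"
    and b: "norm b \<le> 1" and a: "norm a < 2 - sqrt 3"
  shows "Re (1 + a * deriv (deriv F) a / deriv F a) \<ge> 0"
proof -
  define r where "r = norm a"
  have "sqrt 3 > 1" by simp
  hence r: "0 \<le> r" "r < 1" using a unfolding r_def by (simp, linarith)
  have a1: "norm a < 1" using r by (simp add: r_def)
  obtain e where e: "norm e \<le> 1" "deriv p a = 3 * p a * e / (1 - e * a)" using e[OF a1] by blast
  have ba: "1 + b * a \<noteq> 0" using one_plus_mult_nz[OF b a1] .
  define X where "X = (e * a) / (1 - e * a)"
  define Y where "Y = (- b * a) / (1 - (- b * a))"
  have "((\<lambda>z. (1 + b * z) * p z) has_field_derivative b * p a + (1 + b * a) * deriv p a) (at a)"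
    using holomorphic_derivI[OF p(1) open_ball, of a] a1 by (auto intro!: derivative_eq_intros)
  hence "(deriv F has_field_derivative b * p a + (1 + b * a) * deriv p a) (at a)"
    by (rule has_field_derivative_transform_within_open[where S = "ball 0 1"]) (use a1 F in auto)
  hence "deriv (deriv F) a = b * p a + (1 + b * a) * deriv p a" by (rule DERIV_imp_deriv)
  hence "a * deriv (deriv F) a / deriv F a = a * b / (1 + b * a) + a * (deriv p a / p a)"
    using ba p(2)[OF a1] by (simp add: F[OF a1] divide_simps) (simp add: algebra_simps)
  also have "a * (deriv p a / p a) = 3 * X"
    using p(2)[OF a1] by (simp add: e(2) X_def)
  also have "a * b / (1 + b * a) = - Y" by (simp add: Y_def mult.commute)
  finally have eq: "Re (1 + a * deriv (deriv F) a / deriv F a) = 1 - Re Y + 3 * Re X" by simp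
  have "norm (e * a) \<le> r" "norm (- b * a) \<le> r"
    using e(1) b by (simp_all add: norm_mult r_def mult_left_le_one_le)
  note bounds = Re_over_one_minus_bounds(1)[OF this(1) r(2)] Re_over_one_minus_bounds(2)[OF this(2) r(2)]
  note bounds = bounds[folded X_def Y_def]
  have "(sqrt 3)\<^sup>2 < (2 - r)\<^sup>2" using a by (intro power_strict_mono) (auto simp: r_def)
  hence "0 \<le> 1 - 4 * r + r\<^sup>2" by (simp add: power2_eq_square algebra_simps)
  hence "0 \<le> (1 - 4 * r + r\<^sup>2) / ((1 - r) * (1 + r))" using r by (intro divide_nonneg_pos mult_pos_pos) auto
  also have "\<dots> = 1 - r / (1 - r) + 3 * (- (r / (1 + r)))"
    using r by (simp add: divide_simps power2_eq_square) (simp add: algebra_simps)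
  also have "\<dots> \<le> Re (1 + a * deriv (deriv F) a / deriv F a)" unfolding eq using bounds by linarith
  finally show ?thesis .
qed

section \<open>Harmonic functions in the class\<close>

theorem theorem3p5:
  fixes \<alpha> :: complex
  assumes "norm \<alpha> \<le> 1"
  shows "(\<forall>f\<in>harmonic_M \<alpha>. convex_domain (f ` ball 0 (2 - sqrt 3))) \<and>
         (\<forall>f\<in>harmonic_M \<alpha>. starlike_domain (f ` ball 0 (4 * sqrt 2 - 5)))"
proof -
  have "convex_domain (f ` ball 0 (2 - sqrt 3)) \<and> starlike_domain (f ` ball 0 (4 * sqrt 2 - 5))"
    if fM: "f \<in> harmonic_M \<alpha>" for f
  proof -
    obtain h g where h: "h holomorphic_on ball 0 1" "h 0 = 0"
      and g: "g holomorphic_on ball 0 1" "g 0 = 0"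
      and fhg: "\<And>z. norm z < 1 \<Longrightarrow> f z = h z + cnj (g z)"
      and dg: "\<And>z. norm z < 1 \<Longrightarrow> deriv g z = \<alpha> * z * deriv h z"
      and nz: "\<And>z. norm z < 1 \<Longrightarrow> deriv h z \<noteq> 0"
      and re: "\<And>z. norm z < 1 \<Longrightarrow> Re (1 + z * deriv (deriv h) z / deriv h z) > - 1 / 2"
      using fM unfolding harmonic_M_def mem_Collect_eq Ball_def mem_ball_0 by blast
    have h': "deriv h holomorphic_on ball 0 1" by (intro holomorphic_deriv h) auto
    note ldf = logarithmic_derivative_form[OF h' nz re]
    have sense: "norm (deriv g z) < norm (deriv h z)" if "norm z < 1" for z
    proof -
      have "norm \<alpha> * norm z \<le> 1 * norm z" using assms by (intro mult_right_mono) auto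
      hence "norm (\<alpha> * z) < 1" using that by (simp add: norm_mult)
      hence "norm (\<alpha> * z) * norm (deriv h z) < 1 * norm (deriv h z)"
        using nz[OF that] by (intro mult_strict_right_mono) auto
      thus ?thesis by (simp add: dg[OF that] norm_mult)
    qed
    have dF: "deriv (\<lambda>z. h z + e * g z) z = (1 + (e * \<alpha>) * z) * deriv h z" if "norm z < 1" for e z
    proof -
      have "((\<lambda>z. h z + e * g z) has_field_derivative (deriv h z + e * deriv g z)) (at z)"
        using holomorphic_derivI[OF h(1) open_ball, of z] holomorphic_derivI[OF g(1) open_ball, of z] that
        by (auto intro!: derivative_eq_intros)
      thus ?thesis by (simp add: DERIV_imp_deriv dg[OF that] algebra_simps)
    qed
    have e\<alpha>: "norm (e * \<alpha>) \<le> 1" if "norm e \<le> 1" for e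
      using assms that by (simp add: norm_mult mult_le_one)
    have R: "harmonic_ball h g R" if "R \<le> 1" for R
      using that sense by unfold_locales (auto intro: holomorphic_on_subset[OF h(1)] holomorphic_on_subset[OF g(1)])
    have f_eq: "f ` ball 0 R = harmonic_ball.f h g ` ball 0 R" if "R \<le> 1" for R
      using that by (intro image_cong refl) (simp add: harmonic_ball.f_def[OF R[OF that]] fhg)
    have "sqrt 3 > 1" "sqrt 3 < 2" by (auto intro: real_less_lsqrt)
    hence Ra: "0 < 2 - sqrt 3" "2 - sqrt 3 \<le> 1" by linarith+
    have "sqrt 2 < 3 / 2" by (rule real_less_lsqrt) (auto simp: power2_eq_square)
    moreover have "5 / 4 < sqrt 2" by (rule real_less_rsqrt) (auto simp: power2_eq_square)
    ultimately have Rb: "0 < 4 * sqrt 2 - 5" "4 * sqrt 2 - 5 \<le> 1" by linarith+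
    have "convex (harmonic_ball.f h g ` ball 0 (2 - sqrt 3))"
    proof (rule harmonic_ball.convex_image[OF R[OF Ra(2)]])
      fix e z :: complex assume "norm e = 1" "z \<in> ball 0 (2 - sqrt 3)"
      thus "0 \<le> Re (1 + z * deriv (deriv (\<lambda>z. h z + e * g z)) z / deriv (\<lambda>z. h z + e * g z) z)"
        by (intro convexity_quotient[OF h' nz ldf dF e\<alpha>]) auto
    qed
    moreover have "starlike_domain (harmonic_ball.f h g ` ball 0 (4 * sqrt 2 - 5))"
    proof (rule harmonic_ball.starlike_image[OF R[OF Rb(2)] Rb(1) h(2) g(2)])
      fix e z :: complex assume e: "norm e \<le> 1" and z: "z \<in> ball 0 (4 * sqrt 2 - 5)" "z \<noteq> 0"
      define F where "F = (\<lambda>z. h z + e * g z)"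
      have "F holomorphic_on ball 0 1" "F 0 = 0" unfolding F_def
        using h g by (auto intro!: holomorphic_intros)
      hence "Re (F z / (z * deriv F z)) > 0"
        using z by (intro starlikeness_quotient[OF h' nz ldf _ _ dF[of _ e, folded F_def] e\<alpha>[OF e]]) auto
      moreover have "Re (1 / w) > 0" if "Re w > 0" for w
      proof -
        have "w \<noteq> 0" using that by auto
        thus ?thesis using that by (simp add: Re_divide')
      qed
      ultimately have "Re (1 / (F z / (z * deriv F z))) > 0" by blast
      thus "0 < Re (z * deriv (\<lambda>z. h z + e * g z) z / (h z + e * g z))" by (simp add: F_def)
    qed
    ultimately show ?thesis
      using harmonic_ball.domain_image[OF R[OF Ra(2)] Ra(1)]
      unfolding f_eq[OF Ra(2)] f_eq[OF Rb(2)] convex_domain_def by blast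
  qed
  thus ?thesis by blast
qed

end
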